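(* Let $\mathcal V$ and $\mathcal W$ be symmetric monoidal categories, let $(M,\mu,\eta,\nabla)$ be a symmetric monoidal monad on $\mathcal W$, let $F\colon \mathcal V\to\mathcal W$ be a (lax) symmetric monoidal functor, let $\mathcal U\hookrightarrow\mathcal W$ be a full strict monoidal subcategory, and let $\mathcal C$ be a (symmetric) monoidal $\mathcal V$-category with underlying (ordinary) monoidal category $\mathcal C_0$. Let $(\mathcal U/MF)_*\mathcal C$ be the nearly strict (symmetric) monoidal 2-category of parametric $M$-uncertain arrows of $\mathcal C$ described in the context. Then there is an identity-on-objects 2-functor $\iota\colon\mathcal C_0\to(\mathcal U/MF)_*\mathcal C$ (with $\mathcal C_0$ viewed as a 2-category with only identity 2-cells) that strictly preserves monoidal products and coherence maps. Moreover, if the functor $F_*^0\colon\mathcal C_0\to(F_*\mathcal C)_0$ and post-composition by $\eta$ (i.e. the functor $L_M\colon\mathcal W\to\mathrm{Kl}_M$, $f\mapsto f;\eta$) are faithful, then $\iota$ is faithful.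
   Context: Notation: $f;g$ denotes composition in diagrammatic order. 2-categories are strict. Symmetric monoidal monad: a monad $(M,\mu,\eta)$ on a symmetric monoidal category $\mathcal W$ with morphisms $\nabla_{X,Y}\colon MX\otimes MY\to M(X\otimes Y)$, natural in $X,Y$, making $M$ a lax symmetric monoidal functor with unit comparison $\eta_I$, and making $\mu$ and $\eta$ monoidal transformations. Its Kleisli category $\mathrm{Kl}_M$ is symmetric monoidal: on objects the product is that of $\mathcal W$, and the product of $f\colon A\to MX$ and $g\colon B\to MY$ is $(f\otimes g);\nabla_{X,Y}$. The identity-on-objects functor $L_M\colon\mathcal W\to\mathrm{Kl}_M$, $f\mapsto f;\eta$, is strict symmetric monoidal. An arrow $A\to B$ of $\mathrm{Kl}_M$ is a $\mathcal W$-arrow $A\to MB$; $h;\eta$ for $h$ in $\mathcal W$ denotes $L_M(h)$. Full strict monoidal subcategory $\mathcal U\hookrightarrow\mathcal W$: a (small) full subcategory containing $I_{\mathcal W}$ and closed under $\otimes$, with strict monoidal inclusion, such that $\mathcal U$ is a strict monoidal category (the associators and unitors on objects of $\mathcal U$ are identities). Underlying category: for a $\mathcal V$-category $\mathcal C$, $\mathcal C_0$ has the same objects and arrows $A\to B$ the $\mathcal V$-arrows $I\to\mathcal C(A,B)$. Monoidal $\mathcal V$-category: a $\mathcal V$-category $\mathcal C$ with a $\mathcal V$-functor $\boxtimes\colon\mathcal C\otimes\mathcal C\to\mathcal C$, a unit object $J$, and $\mathcal V$-natural isomorphisms $a_{A,B,C}\colon I\to\mathcal C((A\boxtimes B)\boxtimes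 C,A\boxtimes(B\boxtimes C))$, $r_A\colon I\to\mathcal C(A\boxtimes J,A)$, $l_A\colon I\to\mathcal C(J\boxtimes A,A)$ making $\mathcal C_0$ (with product of $f_1,f_2$ given by $I\cong I\otimes I\xrightarrow{f_1\otimes f_2}\mathcal C(A_1,B_1)\otimes\mathcal C(A_2,B_2)\xrightarrow{\boxtimes}\mathcal C(A_1\boxtimes A_2,B_1\boxtimes B_2)$) a monoidal category. It is symmetric if it also has a $\mathcal V$-natural isomorphism $s_{A,B}\colon I\to\mathcal C(A\boxtimes B,B\boxtimes A)$ making $\mathcal C_0$ symmetric monoidal. Change of base along $F$: $F_*\mathcal C$ is the $\mathcal W$-category with the objects of $\mathcal C$, hom-objects $F\mathcal C(A,B)$, composition $\widetilde F;F(;_{\mathcal C})$ and identities $F_\epsilon;F(\mathrm{id}_A)$, where $F_\epsilon\colon I_{\mathcal W}\to FI_{\mathcal V}$ and $\widetilde F_{A,B}\colon FA\otimes FB\to F(A\otimes B)$ are the comparison maps of $F$. The functor $F_*^0\colon\mathcal C_0\to(F_*\mathcal C)_0$ is the identity on objects and sends $f\colon I_{\mathcal V}\to\mathcal C(A,B)$ to $F_\epsilon;Ff$. The 2-category $(\mathcal U/MF)_*\mathcal C$: 0-cells are the objects of $\mathcal C$. 1-cells $X\to Y$ are $\mathrm{Kl}_M$-arrows $f\colon U\to F\mathcal C(X,Y)$ with $U\in\mathcal U$. 2-cells from $f\colon U\to F\mathcal C(X,Y)$ to $g\colon V\to F\mathcal C(X,Y)$ are $\mathrm{Kl}_M$-arrows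 $\varphi\colon U\to V$ with $f=\varphi;g$, composing vertically as in $\mathrm{Kl}_M$. The horizontal composite of $f_1\colon U_1\to F\mathcal C(X,Y)$ and $f_2\colon U_2\to F\mathcal C(Y,Z)$ is the $\mathrm{Kl}_M$-composite of $f_1\otimes f_2\colon U_1\otimes U_2\to F\mathcal C(X,Y)\otimes F\mathcal C(Y,Z)$ with $\widetilde F;F(;_{\mathcal C});\eta$, and of 2-cells it is $\varphi_1\otimes\varphi_2$. Identities are $F_\epsilon;F(\mathrm{id}_X);\eta\colon I_{\mathcal W}\to F\mathcal C(X,X)$. The monoidal product of 0-cells is that of $\mathcal C$, with the same unit; that of 1-cells $f_i\colon U_i\to F\mathcal C(X_i,Y_i)$ is the $\mathrm{Kl}_M$-composite of $f_1\otimes f_2$ with $\widetilde F;F(\boxtimes);\eta$; that of 2-cells is $\varphi_1\otimes\varphi_2$. Interchange holds up to invertible 2-cells given by the coherence isomorphism exchanging the two middle parameter objects. The coherence 1-cells are $F_\epsilon;F(c);\eta\colon I_{\mathcal W}\to F\mathcal C(-,-)$ for $c$ the corresponding components of $a,r,l$ (and $s$) of $\mathcal C$. *)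

theory Defs
  imports Main
begin

text \<open>Composition is written in diagrammatic order throughout.\<close>

section \<open>Categories and functors\<close>

record ('o, 'a) cat =
  Obj :: "'o set"
  Arr :: "'a set"
  Dom :: "'a \<Rightarrow> 'o"
  Cod :: "'a \<Rightarrow> 'o"
  Ide :: "'o \<Rightarrow> 'a"
  Comp :: "'a \<Rightarrow> 'a \<Rightarrow> 'a"  (infixl "\<Zsemi>\<index>" 60)

definition hom :: "('o, 'a, 'x) cat_scheme \<Rightarrow> 'o \<Rightarrow> 'o \<Rightarrow> 'a set" where
  "hom C A B = {f \<in> Arr C. Dom C f = A \<and> Cod C f = B}"

locale category =
  fixes C :: "('o, 'a, 'x) cat_scheme" (structure)
  assumes dom_obj: "f \<in> Arr C \<Longrightarrow> Dom C f \<in> Obj C"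
    and cod_obj: "f \<in> Arr C \<Longrightarrow> Cod C f \<in> Obj C"
    and ide_hom: "A \<in> Obj C \<Longrightarrow> Ide C A \<in> hom C A A"
    and comp_hom: "\<lbrakk>f \<in> hom C A B; g \<in> hom C B D\<rbrakk> \<Longrightarrow> f \<Zsemi> g \<in> hom C A D"
    and ide_comp: "f \<in> hom C A B \<Longrightarrow> Ide C A \<Zsemi> f = f"
    and comp_ide: "f \<in> hom C A B \<Longrightarrow> f \<Zsemi> Ide C B = f"
    and comp_assoc:
      "\<lbrakk>f \<in> hom C A B; g \<in> hom C B D; h \<in> hom C D E\<rbrakk> \<Longrightarrow> (f \<Zsemi> g) \<Zsemi> h = f \<Zsemi> (g \<Zsemi> h)"

definition inverse_arrows :: "('o, 'a, 'x) cat_scheme \<Rightarrow> 'a \<Rightarrow> 'a \<Rightarrow> bool" where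
  "inverse_arrows C f g \<longleftrightarrow>
     f \<in> Arr C \<and> g \<in> hom C (Cod C f) (Dom C f) \<and>
     f \<Zsemi>\<^bsub>C\<^esub> g = Ide C (Dom C f) \<and> g \<Zsemi>\<^bsub>C\<^esub> f = Ide C (Cod C f)"

definition is_iso :: "('o, 'a, 'x) cat_scheme \<Rightarrow> 'a \<Rightarrow> bool" where
  "is_iso C f \<longleftrightarrow> (\<exists>g. inverse_arrows C f g)"

definition inv_arr :: "('o, 'a, 'x) cat_scheme \<Rightarrow> 'a \<Rightarrow> 'a" where
  "inv_arr C f = (THE g. inverse_arrows C f g)"

record ('o, 'a, 'p, 'b) func =
  FO :: "'o \<Rightarrow> 'p"
  FA :: "'a \<Rightarrow> 'b"

locale is_functor =
  C: category C + D: category D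
  for C :: "('o, 'a, 'x) cat_scheme" and D :: "('p, 'b, 'y) cat_scheme" +
  fixes F :: "('o, 'a, 'p, 'b, 'z) func_scheme"
  assumes obj: "A \<in> Obj C \<Longrightarrow> FO F A \<in> Obj D"
    and arr: "f \<in> hom C A B \<Longrightarrow> FA F f \<in> hom D (FO F A) (FO F B)"
    and ide: "A \<in> Obj C \<Longrightarrow> FA F (Ide C A) = Ide D (FO F A)"
    and comp: "\<lbrakk>f \<in> hom C A B; g \<in> hom C B E\<rbrakk> \<Longrightarrow> FA F (f \<Zsemi>\<^bsub>C\<^esub> g) = FA F f \<Zsemi>\<^bsub>D\<^esub> FA F g"

definition faithful ::
  "('o, 'a, 'x) cat_scheme \<Rightarrow> ('o, 'a, 'p, 'b, 'z) func_scheme \<Rightarrow> bool" where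
  "faithful C F \<longleftrightarrow> (\<forall>A\<in>Obj C. \<forall>B\<in>Obj C. inj_on (FA F) (hom C A B))"

section \<open>Symmetric monoidal categories\<close>

record ('o, 'a) smcat = "('o, 'a) cat" +
  TenO :: "'o \<Rightarrow> 'o \<Rightarrow> 'o"  (infixr "\<odot>\<index>" 70)
  TenA :: "'a \<Rightarrow> 'a \<Rightarrow> 'a"  (infixr "\<otimes>\<index>" 70)
  Unit :: "'o"
  Assoc :: "'o \<Rightarrow> 'o \<Rightarrow> 'o \<Rightarrow> 'a"
  LUni :: "'o \<Rightarrow> 'a"
  RUni :: "'o \<Rightarrow> 'a"
  Sym :: "'o \<Rightarrow> 'o \<Rightarrow> 'a"

text \<open>The field \<^const>\<open>Sym\<close> is unconstrained in a monoidal category that is not assumed symmetric.\<close>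

locale monoidal_category = category C
  for C :: "('o, 'a, 'x) smcat_scheme" (structure) +
  assumes tenO: "\<lbrakk>A \<in> Obj C; B \<in> Obj C\<rbrakk> \<Longrightarrow> A \<odot> B \<in> Obj C"
    and tenA: "\<lbrakk>f \<in> hom C A B; g \<in> hom C A' B'\<rbrakk> \<Longrightarrow> f \<otimes> g \<in> hom C (A \<odot> A') (B \<odot> B')"
    and ten_ide: "\<lbrakk>A \<in> Obj C; B \<in> Obj C\<rbrakk> \<Longrightarrow> Ide C A \<otimes> Ide C B = Ide C (A \<odot> B)"
    and ten_comp:
      "\<lbrakk>f \<in> hom C A B; g \<in> hom C B D; f' \<in> hom C A' B'; g' \<in> hom C B' D'\<rbrakk>
        \<Longrightarrow> (f \<Zsemi> g) \<otimes> (f' \<Zsemi> g') = (f \<otimes> f') \<Zsemi> (g \<otimes> g')"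
    and unit: "Unit C \<in> Obj C"
    and assoc_hom:
      "\<lbrakk>A \<in> Obj C; B \<in> Obj C; D \<in> Obj C\<rbrakk>
        \<Longrightarrow> Assoc C A B D \<in> hom C ((A \<odot> B) \<odot> D) (A \<odot> (B \<odot> D))"
    and assoc_iso: "\<lbrakk>A \<in> Obj C; B \<in> Obj C; D \<in> Obj C\<rbrakk> \<Longrightarrow> is_iso C (Assoc C A B D)"
    and assoc_nat:
      "\<lbrakk>f \<in> hom C A A'; g \<in> hom C B B'; h \<in> hom C D D'\<rbrakk>
        \<Longrightarrow> ((f \<otimes> g) \<otimes> h) \<Zsemi> Assoc C A' B' D' = Assoc C A B D \<Zsemi> (f \<otimes> (g \<otimes> h))"
    and luni_hom: "A \<in> Obj C \<Longrightarrow> LUni C A \<in> hom C (Unit C \<odot> A) A"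
    and luni_iso: "A \<in> Obj C \<Longrightarrow> is_iso C (LUni C A)"
    and luni_nat: "f \<in> hom C A B \<Longrightarrow> (Ide C (Unit C) \<otimes> f) \<Zsemi> LUni C B = LUni C A \<Zsemi> f"
    and runi_hom: "A \<in> Obj C \<Longrightarrow> RUni C A \<in> hom C (A \<odot> Unit C) A"
    and runi_iso: "A \<in> Obj C \<Longrightarrow> is_iso C (RUni C A)"
    and runi_nat: "f \<in> hom C A B \<Longrightarrow> (f \<otimes> Ide C (Unit C)) \<Zsemi> RUni C B = RUni C A \<Zsemi> f"
    and pentagon:
      "\<lbrakk>A \<in> Obj C; B \<in> Obj C; D \<in> Obj C; E \<in> Obj C\<rbrakk>
        \<Longrightarrow> Assoc C (A \<odot> B) D E \<Zsemi> Assoc C A B (D \<odot> E)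
          = (Assoc C A B D \<otimes> Ide C E) \<Zsemi> Assoc C A (B \<odot> D) E \<Zsemi> (Ide C A \<otimes> Assoc C B D E)"
    and triangle:
      "\<lbrakk>A \<in> Obj C; B \<in> Obj C\<rbrakk>
        \<Longrightarrow> Assoc C A (Unit C) B \<Zsemi> (Ide C A \<otimes> LUni C B) = RUni C A \<otimes> Ide C B"

locale symmetric_monoidal_category = monoidal_category C
  for C :: "('o, 'a, 'x) smcat_scheme" (structure) +
  assumes sym_hom: "\<lbrakk>A \<in> Obj C; B \<in> Obj C\<rbrakk> \<Longrightarrow> Sym C A B \<in> hom C (A \<odot> B) (B \<odot> A)"
    and sym_nat:
      "\<lbrakk>f \<in> hom C A A'; g \<in> hom C B B'\<rbrakk> \<Longrightarrow> (f \<otimes> g) \<Zsemi> Sym C A' B' = Sym C A B \<Zsemi> (g \<otimes> f)"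
    and sym_sym: "\<lbrakk>A \<in> Obj C; B \<in> Obj C\<rbrakk> \<Longrightarrow> Sym C A B \<Zsemi> Sym C B A = Ide C (A \<odot> B)"
    and sym_unit: "A \<in> Obj C \<Longrightarrow> Sym C A (Unit C) \<Zsemi> LUni C A = RUni C A"
    and hexagon:
      "\<lbrakk>A \<in> Obj C; B \<in> Obj C; D \<in> Obj C\<rbrakk>
        \<Longrightarrow> Assoc C A B D \<Zsemi> Sym C A (B \<odot> D) \<Zsemi> Assoc C B D A
          = (Sym C A B \<otimes> Ide C D) \<Zsemi> Assoc C B A D \<Zsemi> (Ide C B \<otimes> Sym C A D)"

text \<open>The coherence isomorphism \<open>(A \<odot> B) \<odot> (A' \<odot> B') \<rightarrow> (A \<odot> A') \<odot> (B \<odot> B')\<close>.\<close>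

definition mid_exchange ::
  "('o, 'a, 'x) smcat_scheme \<Rightarrow> 'o \<Rightarrow> 'o \<Rightarrow> 'o \<Rightarrow> 'o \<Rightarrow> 'a" where
  "mid_exchange V A B A' B' =
     Assoc V A B (A' \<odot>\<^bsub>V\<^esub> B')
     \<Zsemi>\<^bsub>V\<^esub> (Ide V A \<otimes>\<^bsub>V\<^esub> (inv_arr V (Assoc V B A' B')
                      \<Zsemi>\<^bsub>V\<^esub> (Sym V B A' \<otimes>\<^bsub>V\<^esub> Ide V B')
                      \<Zsemi>\<^bsub>V\<^esub> Assoc V A' B B'))
     \<Zsemi>\<^bsub>V\<^esub> inv_arr V (Assoc V A A' (B \<odot>\<^bsub>V\<^esub> B'))"

text \<open>
  A full subcategory is determined by its set of objects. The inclusion of the full subcategory on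
  \<open>U\<close> is strict monoidal because its tensor, unit and coherence maps are inherited from \<open>W\<close>.
\<close>

locale full_strict_monoidal_subcategory =
  fixes W :: "('o, 'a, 'x) smcat_scheme" (structure) and U :: "'o set"
  assumes sub: "U \<subseteq> Obj W"
    and unit_in: "Unit W \<in> U"
    and ten_in: "\<lbrakk>A \<in> U; B \<in> U\<rbrakk> \<Longrightarrow> A \<odot> B \<in> U"
    and ten_assoc: "\<lbrakk>A \<in> U; B \<in> U; D \<in> U\<rbrakk> \<Longrightarrow> (A \<odot> B) \<odot> D = A \<odot> (B \<odot> D)"
    and unit_ten: "A \<in> U \<Longrightarrow> Unit W \<odot> A = A"
    and ten_unit: "A \<in> U \<Longrightarrow> A \<odot> Unit W = A"
    and assoc_ide: "\<lbrakk>A \<in> U; B \<in> U; D \<in> U\<rbrakk> \<Longrightarrow> Assoc W A B D = Ide W (A \<odot> (B \<odot> D))"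
    and luni_ide: "A \<in> U \<Longrightarrow> LUni W A = Ide W A"
    and runi_ide: "A \<in> U \<Longrightarrow> RUni W A = Ide W A"

section \<open>Lax symmetric monoidal functors and symmetric monoidal monads\<close>

record ('o, 'a, 'p, 'b) lax_func = "('o, 'a, 'p, 'b) func" +
  LaxU :: "'b"
  LaxT :: "'o \<Rightarrow> 'o \<Rightarrow> 'b"

locale lax_symmetric_monoidal_functor =
  is_functor V W F + V: symmetric_monoidal_category V + W: symmetric_monoidal_category W
  for V :: "('o, 'a, 'x) smcat_scheme" and W :: "('p, 'b, 'y) smcat_scheme"
    and F :: "('o, 'a, 'p, 'b, 'z) lax_func_scheme" +
  assumes laxU_hom: "LaxU F \<in> hom W (Unit W) (FO F (Unit V))"
    and laxT_hom:
      "\<lbrakk>A \<in> Obj V; B \<in> Obj V\<rbrakk> \<Longrightarrow> LaxT F A B \<in> hom W (FO F A \<odot>\<^bsub>W\<^esub> FO F B) (FO F (A \<odot>\<^bsub>V\<^esub> B))"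
    and laxT_nat:
      "\<lbrakk>f \<in> hom V A A'; g \<in> hom V B B'\<rbrakk>
        \<Longrightarrow> (FA F f \<otimes>\<^bsub>W\<^esub> FA F g) \<Zsemi>\<^bsub>W\<^esub> LaxT F A' B' = LaxT F A B \<Zsemi>\<^bsub>W\<^esub> FA F (f \<otimes>\<^bsub>V\<^esub> g)"
    and lax_assoc:
      "\<lbrakk>A \<in> Obj V; B \<in> Obj V; D \<in> Obj V\<rbrakk>
        \<Longrightarrow> (LaxT F A B \<otimes>\<^bsub>W\<^esub> Ide W (FO F D)) \<Zsemi>\<^bsub>W\<^esub> LaxT F (A \<odot>\<^bsub>V\<^esub> B) D \<Zsemi>\<^bsub>W\<^esub> FA F (Assoc V A B D)
          = Assoc W (FO F A) (FO F B) (FO F D)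
            \<Zsemi>\<^bsub>W\<^esub> (Ide W (FO F A) \<otimes>\<^bsub>W\<^esub> LaxT F B D) \<Zsemi>\<^bsub>W\<^esub> LaxT F A (B \<odot>\<^bsub>V\<^esub> D)"
    and lax_luni:
      "A \<in> Obj V
        \<Longrightarrow> (LaxU F \<otimes>\<^bsub>W\<^esub> Ide W (FO F A)) \<Zsemi>\<^bsub>W\<^esub> LaxT F (Unit V) A \<Zsemi>\<^bsub>W\<^esub> FA F (LUni V A)
          = LUni W (FO F A)"
    and lax_runi:
      "A \<in> Obj V
        \<Longrightarrow> (Ide W (FO F A) \<otimes>\<^bsub>W\<^esub> LaxU F) \<Zsemi>\<^bsub>W\<^esub> LaxT F A (Unit V) \<Zsemi>\<^bsub>W\<^esub> FA F (RUni V A)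
          = RUni W (FO F A)"
    and lax_sym:
      "\<lbrakk>A \<in> Obj V; B \<in> Obj V\<rbrakk>
        \<Longrightarrow> LaxT F A B \<Zsemi>\<^bsub>W\<^esub> FA F (Sym V A B) = Sym W (FO F A) (FO F B) \<Zsemi>\<^bsub>W\<^esub> LaxT F B A"

definition id_lax :: "('o, 'a, 'x) smcat_scheme \<Rightarrow> ('o, 'a, 'o, 'a) lax_func" where
  "id_lax W = \<lparr>FO = \<lambda>A. A, FA = \<lambda>f. f,
     LaxU = Ide W (Unit W), LaxT = \<lambda>A B. Ide W (A \<odot>\<^bsub>W\<^esub> B)\<rparr>"

text \<open>\<open>comp_lax X F G\<close> is \<open>F\<close> followed by \<open>G\<close>, where \<open>X\<close> is the codomain of \<open>G\<close>.\<close>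

definition comp_lax ::
  "('q, 'c, 'x) smcat_scheme \<Rightarrow> ('o, 'a, 'p, 'b) lax_func \<Rightarrow> ('p, 'b, 'q, 'c) lax_func
    \<Rightarrow> ('o, 'a, 'q, 'c) lax_func" where
  "comp_lax X F G = \<lparr>FO = \<lambda>A. FO G (FO F A), FA = \<lambda>f. FA G (FA F f),
     LaxU = LaxU G \<Zsemi>\<^bsub>X\<^esub> FA G (LaxU F),
     LaxT = \<lambda>A B. LaxT G (FO F A) (FO F B) \<Zsemi>\<^bsub>X\<^esub> FA G (LaxT F A B)\<rparr>"

locale monoidal_transformation =
  fixes V :: "('o, 'a, 'x) smcat_scheme" and W :: "('p, 'b, 'y) smcat_scheme"
    and F :: "('o, 'a, 'p, 'b) lax_func" and G :: "('o, 'a, 'p, 'b) lax_func"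
    and \<alpha> :: "'o \<Rightarrow> 'b"
  assumes component: "A \<in> Obj V \<Longrightarrow> \<alpha> A \<in> hom W (FO F A) (FO G A)"
    and natural: "f \<in> hom V A B \<Longrightarrow> FA F f \<Zsemi>\<^bsub>W\<^esub> \<alpha> B = \<alpha> A \<Zsemi>\<^bsub>W\<^esub> FA G f"
    and mon_unit: "LaxU F \<Zsemi>\<^bsub>W\<^esub> \<alpha> (Unit V) = LaxU G"
    and mon_ten:
      "\<lbrakk>A \<in> Obj V; B \<in> Obj V\<rbrakk>
        \<Longrightarrow> LaxT F A B \<Zsemi>\<^bsub>W\<^esub> \<alpha> (A \<odot>\<^bsub>V\<^esub> B) = (\<alpha> A \<otimes>\<^bsub>W\<^esub> \<alpha> B) \<Zsemi>\<^bsub>W\<^esub> LaxT G A B"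

record ('o, 'a) mon_monad = "('o, 'a, 'o, 'a) func" +
  Mult :: "'o \<Rightarrow> 'a"
  Eta :: "'o \<Rightarrow> 'a"
  Nabla :: "'o \<Rightarrow> 'o \<Rightarrow> 'a"

definition monad_lax :: "('o, 'a, 'x) smcat_scheme \<Rightarrow> ('o, 'a) mon_monad \<Rightarrow> ('o, 'a, 'o, 'a) lax_func" where
  "monad_lax W M = \<lparr>FO = FO M, FA = FA M, LaxU = Eta M (Unit W), LaxT = Nabla M\<rparr>"

locale symmetric_monoidal_monad =
  lax: lax_symmetric_monoidal_functor W W "monad_lax W M" +
  mult: monoidal_transformation W W "comp_lax W (monad_lax W M) (monad_lax W M)" "monad_lax W M" "Mult M" +
  eta: monoidal_transformation W W "id_lax W" "monad_lax W M" "Eta M"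
  for W :: "('o, 'a, 'x) smcat_scheme" and M :: "('o, 'a) mon_monad" +
  assumes mult_assoc:
      "A \<in> Obj W \<Longrightarrow> FA M (Mult M A) \<Zsemi>\<^bsub>W\<^esub> Mult M A = Mult M (FO M A) \<Zsemi>\<^bsub>W\<^esub> Mult M A"
    and eta_mult: "A \<in> Obj W \<Longrightarrow> Eta M (FO M A) \<Zsemi>\<^bsub>W\<^esub> Mult M A = Ide W (FO M A)"
    and map_eta_mult: "A \<in> Obj W \<Longrightarrow> FA M (Eta M A) \<Zsemi>\<^bsub>W\<^esub> Mult M A = Ide W (FO M A)"

text \<open>
  The Kleisli arrow \<open>(A, f, B)\<close> is \<open>f : A \<rightarrow> M B\<close> regarded as an arrow from \<open>A\<close> to \<open>B\<close>;
  \<open>B\<close> is recorded because \<open>M B\<close> need not determine it.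
\<close>

definition kl_functor ::
  "('o, 'a, 'x) smcat_scheme \<Rightarrow> ('o, 'a) mon_monad \<Rightarrow> ('o, 'a, 'o, 'o \<times> 'a \<times> 'o) func" where
  "kl_functor W M =
     \<lparr>FO = \<lambda>A. A, FA = \<lambda>f. (Dom W f, f \<Zsemi>\<^bsub>W\<^esub> Eta M (Cod W f), Cod W f)\<rparr>"

definition kleisli ::
  "('o, 'a, 'x) smcat_scheme \<Rightarrow> ('o, 'a) mon_monad \<Rightarrow> ('o, 'o \<times> 'a \<times> 'o) smcat" where
  "kleisli W M =
     \<lparr>Obj = Obj W,
      Arr = {(A, f, B). A \<in> Obj W \<and> B \<in> Obj W \<and> f \<in> hom W A (FO M B)},
      Dom = \<lambda>(A, f, B). A,
      Cod = \<lambda>(A, f, B). B,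
      Ide = \<lambda>A. (A, Eta M A, A),
      Comp = \<lambda>(A, f, B) (B', g, D). (A, f \<Zsemi>\<^bsub>W\<^esub> FA M g \<Zsemi>\<^bsub>W\<^esub> Mult M D, D),
      TenO = TenO W,
      TenA = \<lambda>(A, f, X) (B, g, Y). (A \<odot>\<^bsub>W\<^esub> B, (f \<otimes>\<^bsub>W\<^esub> g) \<Zsemi>\<^bsub>W\<^esub> Nabla M X Y, X \<odot>\<^bsub>W\<^esub> Y),
      Unit = Unit W,
      Assoc = \<lambda>A B D. FA (kl_functor W M) (Assoc W A B D),
      LUni = \<lambda>A. FA (kl_functor W M) (LUni W A),
      RUni = \<lambda>A. FA (kl_functor W M) (RUni W A),
      Sym = \<lambda>A B. FA (kl_functor W M) (Sym W A B)\<rparr>"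

section \<open>Enriched categories\<close>

record ('c, 'o, 'a) vcat =
  VObj :: "'c set"
  VHom :: "'c \<Rightarrow> 'c \<Rightarrow> 'o"
  VComp :: "'c \<Rightarrow> 'c \<Rightarrow> 'c \<Rightarrow> 'a"
  VId :: "'c \<Rightarrow> 'a"

locale vcategory = V: symmetric_monoidal_category V
  for V :: "('o, 'a, 'x) smcat_scheme" (structure) +
  fixes C :: "('c, 'o, 'a, 'y) vcat_scheme"
  assumes vhom: "\<lbrakk>A \<in> VObj C; B \<in> VObj C\<rbrakk> \<Longrightarrow> VHom C A B \<in> Obj V"
    and vcomp_hom:
      "\<lbrakk>A \<in> VObj C; B \<in> VObj C; D \<in> VObj C\<rbrakk>
        \<Longrightarrow> VComp C A B D \<in> hom V (VHom C A B \<odot> VHom C B D) (VHom C A D)"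
    and vid_hom: "A \<in> VObj C \<Longrightarrow> VId C A \<in> hom V (Unit V) (VHom C A A)"
    and vcomp_assoc:
      "\<lbrakk>A \<in> VObj C; B \<in> VObj C; D \<in> VObj C; E \<in> VObj C\<rbrakk>
        \<Longrightarrow> (VComp C A B D \<otimes> Ide V (VHom C D E)) \<Zsemi> VComp C A D E
          = Assoc V (VHom C A B) (VHom C B D) (VHom C D E)
            \<Zsemi> (Ide V (VHom C A B) \<otimes> VComp C B D E) \<Zsemi> VComp C A B E"
    and vid_comp:
      "\<lbrakk>A \<in> VObj C; B \<in> VObj C\<rbrakk>
        \<Longrightarrow> (VId C A \<otimes> Ide V (VHom C A B)) \<Zsemi> VComp C A A B = LUni V (VHom C A B)"
    and vcomp_id:
      "\<lbrakk>A \<in> VObj C; B \<in> VObj C\<rbrakk>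
        \<Longrightarrow> (Ide V (VHom C A B) \<otimes> VId C B) \<Zsemi> VComp C A B B = RUni V (VHom C A B)"

definition vtensor ::
  "('o, 'a, 'x) smcat_scheme \<Rightarrow> ('c, 'o, 'a, 'y) vcat_scheme \<Rightarrow> ('d, 'o, 'a, 'z) vcat_scheme
    \<Rightarrow> ('c \<times> 'd, 'o, 'a) vcat" where
  "vtensor V C D =
     \<lparr>VObj = VObj C \<times> VObj D,
      VHom = \<lambda>(A, B) (A', B'). VHom C A A' \<odot>\<^bsub>V\<^esub> VHom D B B',
      VComp = \<lambda>(A, B) (A', B') (A'', B'').
        mid_exchange V (VHom C A A') (VHom D B B') (VHom C A' A'') (VHom D B' B'')
        \<Zsemi>\<^bsub>V\<^esub> (VComp C A A' A'' \<otimes>\<^bsub>V\<^esub> VComp D B B' B''),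
      VId = \<lambda>(A, B). inv_arr V (LUni V (Unit V)) \<Zsemi>\<^bsub>V\<^esub> (VId C A \<otimes>\<^bsub>V\<^esub> VId D B)\<rparr>"

record ('c, 'd, 'a) vfunc =
  VFO :: "'c \<Rightarrow> 'd"
  VFA :: "'c \<Rightarrow> 'c \<Rightarrow> 'a"

locale vfunctor = C: vcategory V C + D: vcategory V D
  for V :: "('o, 'a, 'x) smcat_scheme" (structure)
    and C :: "('c, 'o, 'a, 'y) vcat_scheme" and D :: "('d, 'o, 'a, 'z) vcat_scheme" +
  fixes S :: "('c, 'd, 'a) vfunc"
  assumes obj: "A \<in> VObj C \<Longrightarrow> VFO S A \<in> VObj D"
    and map: "\<lbrakk>A \<in> VObj C; B \<in> VObj C\<rbrakk> \<Longrightarrow> VFA S A B \<in> hom V (VHom C A B) (VHom D (VFO S A) (VFO S B))"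
    and map_id: "A \<in> VObj C \<Longrightarrow> VId C A \<Zsemi> VFA S A A = VId D (VFO S A)"
    and map_comp:
      "\<lbrakk>A \<in> VObj C; B \<in> VObj C; E \<in> VObj C\<rbrakk>
        \<Longrightarrow> VComp C A B E \<Zsemi> VFA S A E
          = (VFA S A B \<otimes> VFA S B E) \<Zsemi> VComp D (VFO S A) (VFO S B) (VFO S E)"

locale vnatural = S: vfunctor V C D S + T: vfunctor V C D T
  for V :: "('o, 'a, 'x) smcat_scheme" (structure)
    and C :: "('c, 'o, 'a, 'y) vcat_scheme" and D :: "('d, 'o, 'a, 'z) vcat_scheme"
    and S :: "('c, 'd, 'a) vfunc" and T :: "('c, 'd, 'a) vfunc" +
  fixes \<alpha> :: "'c \<Rightarrow> 'a"
  assumes component: "A \<in> VObj C \<Longrightarrow> \<alpha> A \<in> hom V (Unit V) (VHom D (VFO S A) (VFO T A))"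
    and natural:
      "\<lbrakk>A \<in> VObj C; B \<in> VObj C\<rbrakk>
        \<Longrightarrow> inv_arr V (LUni V (VHom C A B)) \<Zsemi> (\<alpha> A \<otimes> VFA T A B)
              \<Zsemi> VComp D (VFO S A) (VFO T A) (VFO T B)
          = inv_arr V (RUni V (VHom C A B)) \<Zsemi> (VFA S A B \<otimes> \<alpha> B)
              \<Zsemi> VComp D (VFO S A) (VFO S B) (VFO T B)"

section \<open>Monoidal enriched categories\<close>

text \<open>
  \<open>VTenA C A\<^sub>1 A\<^sub>2 B\<^sub>1 B\<^sub>2 : C(A\<^sub>1, B\<^sub>1) \<odot> C(A\<^sub>2, B\<^sub>2) \<rightarrow> C(A\<^sub>1 \<boxtimes> A\<^sub>2, B\<^sub>1 \<boxtimes> B\<^sub>2)\<close>.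
  The field \<open>VSym\<close> is unconstrained unless the monoidal structure is assumed symmetric.
\<close>

record ('c, 'o, 'a) mvcat = "('c, 'o, 'a) vcat" +
  VTenO :: "'c \<Rightarrow> 'c \<Rightarrow> 'c"
  VTenA :: "'c \<Rightarrow> 'c \<Rightarrow> 'c \<Rightarrow> 'c \<Rightarrow> 'a"
  VUnit :: "'c"
  VAssoc :: "'c \<Rightarrow> 'c \<Rightarrow> 'c \<Rightarrow> 'a"
  VLUni :: "'c \<Rightarrow> 'a"
  VRUni :: "'c \<Rightarrow> 'a"
  VSym :: "'c \<Rightarrow> 'c \<Rightarrow> 'a"

text \<open>The \<open>V\<close>-functors between which the coherence maps are \<open>V\<close>-natural:\<close>

definition id_fun :: "('o, 'a, 'x) smcat_scheme \<Rightarrow> ('c, 'o, 'a, 'y) vcat_scheme \<Rightarrow> ('c, 'c, 'a) vfunc" where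
  "id_fun V C = \<lparr>VFO = \<lambda>A. A, VFA = \<lambda>A A'. Ide V (VHom C A A')\<rparr>"

definition ten_fun :: "('c, 'o, 'a, 'y) mvcat_scheme \<Rightarrow> ('c \<times> 'c, 'c, 'a) vfunc" where
  "ten_fun C = \<lparr>VFO = \<lambda>(A, B). VTenO C A B, VFA = \<lambda>(A, B) (A', B'). VTenA C A B A' B'\<rparr>"

definition ten_swap_fun ::
  "('o, 'a, 'x) smcat_scheme \<Rightarrow> ('c, 'o, 'a, 'y) mvcat_scheme \<Rightarrow> ('c \<times> 'c, 'c, 'a) vfunc" where
  "ten_swap_fun V C =
     \<lparr>VFO = \<lambda>(A, B). VTenO C B A,
      VFA = \<lambda>(A, B) (A', B'). Sym V (VHom C A A') (VHom C B B') \<Zsemi>\<^bsub>V\<^esub> VTenA C B A B' A'\<rparr>"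

definition ten_left_fun ::
  "('o, 'a, 'x) smcat_scheme \<Rightarrow> ('c, 'o, 'a, 'y) mvcat_scheme \<Rightarrow> (('c \<times> 'c) \<times> 'c, 'c, 'a) vfunc" where
  "ten_left_fun V C =
     \<lparr>VFO = \<lambda>((A, B), D). VTenO C (VTenO C A B) D,
      VFA = \<lambda>((A, B), D) ((A', B'), D').
        (VTenA C A B A' B' \<otimes>\<^bsub>V\<^esub> Ide V (VHom C D D'))
        \<Zsemi>\<^bsub>V\<^esub> VTenA C (VTenO C A B) D (VTenO C A' B') D'\<rparr>"

definition ten_right_fun ::
  "('o, 'a, 'x) smcat_scheme \<Rightarrow> ('c, 'o, 'a, 'y) mvcat_scheme \<Rightarrow> (('c \<times> 'c) \<times> 'c, 'c, 'a) vfunc" where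
  "ten_right_fun V C =
     \<lparr>VFO = \<lambda>((A, B), D). VTenO C A (VTenO C B D),
      VFA = \<lambda>((A, B), D) ((A', B'), D').
        Assoc V (VHom C A A') (VHom C B B') (VHom C D D')
        \<Zsemi>\<^bsub>V\<^esub> (Ide V (VHom C A A') \<otimes>\<^bsub>V\<^esub> VTenA C B D B' D')
        \<Zsemi>\<^bsub>V\<^esub> VTenA C A (VTenO C B D) A' (VTenO C B' D')\<rparr>"

definition unit_left_fun ::
  "('o, 'a, 'x) smcat_scheme \<Rightarrow> ('c, 'o, 'a, 'y) mvcat_scheme \<Rightarrow> ('c, 'c, 'a) vfunc" where
  "unit_left_fun V C =
     \<lparr>VFO = \<lambda>A. VTenO C (VUnit C) A,
      VFA = \<lambda>A A'. inv_arr V (LUni V (VHom C A A'))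
        \<Zsemi>\<^bsub>V\<^esub> (VId C (VUnit C) \<otimes>\<^bsub>V\<^esub> Ide V (VHom C A A'))
        \<Zsemi>\<^bsub>V\<^esub> VTenA C (VUnit C) A (VUnit C) A'\<rparr>"

definition unit_right_fun ::
  "('o, 'a, 'x) smcat_scheme \<Rightarrow> ('c, 'o, 'a, 'y) mvcat_scheme \<Rightarrow> ('c, 'c, 'a) vfunc" where
  "unit_right_fun V C =
     \<lparr>VFO = \<lambda>A. VTenO C A (VUnit C),
      VFA = \<lambda>A A'. inv_arr V (RUni V (VHom C A A'))
        \<Zsemi>\<^bsub>V\<^esub> (Ide V (VHom C A A') \<otimes>\<^bsub>V\<^esub> VId C (VUnit C))
        \<Zsemi>\<^bsub>V\<^esub> VTenA C A (VUnit C) A' (VUnit C)\<rparr>"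

text \<open>
  The underlying category. The arrow \<open>(A, f, B)\<close> is \<open>f : I \<rightarrow> C(A, B)\<close>; its endpoints are recorded
  because \<open>C(A, B)\<close> need not determine them.
\<close>

definition underlying ::
  "('o, 'a, 'x) smcat_scheme \<Rightarrow> ('c, 'o, 'a, 'y) vcat_scheme \<Rightarrow> ('c, 'c \<times> 'a \<times> 'c) cat" where
  "underlying V C =
     \<lparr>Obj = VObj C,
      Arr = {(A, f, B). A \<in> VObj C \<and> B \<in> VObj C \<and> f \<in> hom V (Unit V) (VHom C A B)},
      Dom = \<lambda>(A, f, B). A,
      Cod = \<lambda>(A, f, B). B,
      Ide = \<lambda>A. (A, VId C A, A),
      Comp = \<lambda>(A, f, B) (B', g, D).
        (A, inv_arr V (LUni V (Unit V)) \<Zsemi>\<^bsub>V\<^esub> (f \<otimes>\<^bsub>V\<^esub> g) \<Zsemi>\<^bsub>V\<^esub> VComp C A B D, D)\<rparr>"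

definition mon_underlying ::
  "('o, 'a, 'x) smcat_scheme \<Rightarrow> ('c, 'o, 'a, 'y) mvcat_scheme \<Rightarrow> ('c, 'c \<times> 'a \<times> 'c) smcat" where
  "mon_underlying V C = cat.extend (underlying V C)
     \<lparr>TenO = VTenO C,
      TenA = \<lambda>(A\<^sub>1, f\<^sub>1, B\<^sub>1) (A\<^sub>2, f\<^sub>2, B\<^sub>2).
        (VTenO C A\<^sub>1 A\<^sub>2,
         inv_arr V (LUni V (Unit V)) \<Zsemi>\<^bsub>V\<^esub> (f\<^sub>1 \<otimes>\<^bsub>V\<^esub> f\<^sub>2) \<Zsemi>\<^bsub>V\<^esub> VTenA C A\<^sub>1 A\<^sub>2 B\<^sub>1 B\<^sub>2,
         VTenO C B\<^sub>1 B\<^sub>2),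
      Unit = VUnit C,
      Assoc = \<lambda>A B D. (VTenO C (VTenO C A B) D, VAssoc C A B D, VTenO C A (VTenO C B D)),
      LUni = \<lambda>A. (VTenO C (VUnit C) A, VLUni C A, A),
      RUni = \<lambda>A. (VTenO C A (VUnit C), VRUni C A, A),
      Sym = \<lambda>A B. (VTenO C A B, VSym C A B, VTenO C B A)\<rparr>"

text \<open>Invertibility of the coherence maps is part of the last assumption of the next two locales.\<close>

locale monoidal_vcategory = vcategory V C
  for V :: "('o, 'a, 'x) smcat_scheme" (structure) and C :: "('c, 'o, 'a, 'y) mvcat_scheme" +
  assumes vten: "vfunctor V (vtensor V C C) C (ten_fun C)"
    and vunit: "VUnit C \<in> VObj C"
    and vassoc:
      "vnatural V (vtensor V (vtensor V C C) C) C (ten_left_fun V C) (ten_right_fun V C)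
         (\<lambda>((A, B), D). VAssoc C A B D)"
    and vluni: "vnatural V C C (unit_left_fun V C) (id_fun V C) (VLUni C)"
    and vruni: "vnatural V C C (unit_right_fun V C) (id_fun V C) (VRUni C)"
    and underlying_monoidal: "monoidal_category (mon_underlying V C)"

locale symmetric_monoidal_vcategory = monoidal_vcategory V C
  for V :: "('o, 'a, 'x) smcat_scheme" (structure) and C :: "('c, 'o, 'a, 'y) mvcat_scheme" +
  assumes vsym: "vnatural V (vtensor V C C) C (ten_fun C) (ten_swap_fun V C) (\<lambda>(A, B). VSym C A B)"
    and underlying_symmetric: "symmetric_monoidal_category (mon_underlying V C)"

section \<open>Change of base\<close>

definition change_base ::
  "('p, 'b, 'x) smcat_scheme \<Rightarrow> ('o, 'a, 'p, 'b) lax_func \<Rightarrow> ('c, 'o, 'a, 'y) vcat_scheme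
    \<Rightarrow> ('c, 'p, 'b) vcat" where
  "change_base W F C =
     \<lparr>VObj = VObj C,
      VHom = \<lambda>A B. FO F (VHom C A B),
      VComp = \<lambda>A B D. LaxT F (VHom C A B) (VHom C B D) \<Zsemi>\<^bsub>W\<^esub> FA F (VComp C A B D),
      VId = \<lambda>A. LaxU F \<Zsemi>\<^bsub>W\<^esub> FA F (VId C A)\<rparr>"

definition change_base_functor ::
  "('p, 'b, 'x) smcat_scheme \<Rightarrow> ('o, 'a, 'p, 'b) lax_func
    \<Rightarrow> ('c, 'c \<times> 'a \<times> 'c, 'c, 'c \<times> 'b \<times> 'c) func" where
  "change_base_functor W F =
     \<lparr>FO = \<lambda>A. A, FA = \<lambda>(A, f, B). (A, LaxU F \<Zsemi>\<^bsub>W\<^esub> FA F f, B)\<rparr>"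

section \<open>2-categories with a monoidal product\<close>

text \<open>
  \<^const>\<open>Obj\<close> and \<^const>\<open>Arr\<close> of \<open>Hor\<close> are the 0-cells and 1-cells; \<^const>\<open>Arr\<close> of \<open>Ver\<close> are the
  2-cells, with vertical composition; \<open>HComp\<close> is horizontal composition of 2-cells.
\<close>

record ('o, 'a, 'b) cat2 =
  Hor :: "('o, 'a) cat"
  Ver :: "('a, 'b) cat"
  HComp :: "'b \<Rightarrow> 'b \<Rightarrow> 'b"  (infixl "\<star>\<index>" 60)

locale two_category =
  fixes K :: "('o, 'a, 'b, 'x) cat2_scheme" (structure)
  assumes hor: "category (Hor K)"
    and ver: "category (Ver K)"
    and ver_obj: "Obj (Ver K) = Arr (Hor K)"
    and parallel:
      "\<alpha> \<in> hom (Ver K) f g \<Longrightarrow> Dom (Hor K) f = Dom (Hor K) g \<and> Cod (Hor K) f = Cod (Hor K) g"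
    and hcomp_hom:
      "\<lbrakk>\<alpha> \<in> hom (Ver K) f f'; \<beta> \<in> hom (Ver K) g g'; Cod (Hor K) f = Dom (Hor K) g\<rbrakk>
        \<Longrightarrow> \<alpha> \<star> \<beta> \<in> hom (Ver K) (f \<Zsemi>\<^bsub>Hor K\<^esub> g) (f' \<Zsemi>\<^bsub>Hor K\<^esub> g')"
    and hcomp_ide:
      "\<lbrakk>f \<in> hom (Hor K) X Y; g \<in> hom (Hor K) Y Z\<rbrakk>
        \<Longrightarrow> Ide (Ver K) f \<star> Ide (Ver K) g = Ide (Ver K) (f \<Zsemi>\<^bsub>Hor K\<^esub> g)"
    and interchange:
      "\<lbrakk>\<alpha> \<in> hom (Ver K) f f'; \<alpha>' \<in> hom (Ver K) f' f'';
        \<beta> \<in> hom (Ver K) g g'; \<beta>' \<in> hom (Ver K) g' g''; Cod (Hor K) f = Dom (Hor K) g\<rbrakk>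
        \<Longrightarrow> (\<alpha> \<Zsemi>\<^bsub>Ver K\<^esub> \<alpha>') \<star> (\<beta> \<Zsemi>\<^bsub>Ver K\<^esub> \<beta>') = (\<alpha> \<star> \<beta>) \<Zsemi>\<^bsub>Ver K\<^esub> (\<alpha>' \<star> \<beta>')"
    and hcomp_assoc:
      "\<lbrakk>\<alpha> \<in> hom (Ver K) f f'; \<beta> \<in> hom (Ver K) g g'; \<gamma> \<in> hom (Ver K) h h';
        Cod (Hor K) f = Dom (Hor K) g; Cod (Hor K) g = Dom (Hor K) h\<rbrakk>
        \<Longrightarrow> (\<alpha> \<star> \<beta>) \<star> \<gamma> = \<alpha> \<star> (\<beta> \<star> \<gamma>)"
    and hcomp_unit_left:
      "\<alpha> \<in> hom (Ver K) f f' \<Longrightarrow> Ide (Ver K) (Ide (Hor K) (Dom (Hor K) f)) \<star> \<alpha> = \<alpha>"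
    and hcomp_unit_right:
      "\<alpha> \<in> hom (Ver K) f f' \<Longrightarrow> \<alpha> \<star> Ide (Ver K) (Ide (Hor K) (Cod (Hor K) f)) = \<alpha>"

text \<open>
  \<open>Inter K f\<^sub>1 g\<^sub>1 f\<^sub>2 g\<^sub>2\<close> is the 2-cell from \<open>(f\<^sub>1 \<Zsemi> g\<^sub>1) \<boxtimes> (f\<^sub>2 \<Zsemi> g\<^sub>2)\<close> to
  \<open>(f\<^sub>1 \<boxtimes> f\<^sub>2) \<Zsemi> (g\<^sub>1 \<boxtimes> g\<^sub>2)\<close>.
\<close>

record ('o, 'a, 'b) mcat2 = "('o, 'a, 'b) cat2" +
  Ten0 :: "'o \<Rightarrow> 'o \<Rightarrow> 'o"
  Ten1 :: "'a \<Rightarrow> 'a \<Rightarrow> 'a"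
  Ten2 :: "'b \<Rightarrow> 'b \<Rightarrow> 'b"
  Unit0 :: "'o"
  Assoc1 :: "'o \<Rightarrow> 'o \<Rightarrow> 'o \<Rightarrow> 'a"
  LUni1 :: "'o \<Rightarrow> 'a"
  RUni1 :: "'o \<Rightarrow> 'a"
  Sym1 :: "'o \<Rightarrow> 'o \<Rightarrow> 'a"
  Inter :: "'a \<Rightarrow> 'a \<Rightarrow> 'a \<Rightarrow> 'a \<Rightarrow> 'b"

record ('o, 'a, 'b, 'p, 'c, 'd) func2 =
  F0 :: "'o \<Rightarrow> 'p"
  F1 :: "'a \<Rightarrow> 'c"
  F2 :: "'b \<Rightarrow> 'd"

locale two_functor = K: two_category K + L: two_category L
  for K :: "('o, 'a, 'b, 'x) cat2_scheme" and L :: "('p, 'c, 'd, 'y) cat2_scheme" +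
  fixes P :: "('o, 'a, 'b, 'p, 'c, 'd) func2"
  assumes hor_functor: "is_functor (Hor K) (Hor L) \<lparr>FO = F0 P, FA = F1 P\<rparr>"
    and ver_functor: "is_functor (Ver K) (Ver L) \<lparr>FO = F1 P, FA = F2 P\<rparr>"
    and hcomp:
      "\<lbrakk>\<alpha> \<in> hom (Ver K) f f'; \<beta> \<in> hom (Ver K) g g'; Cod (Hor K) f = Dom (Hor K) g\<rbrakk>
        \<Longrightarrow> F2 P (\<alpha> \<star>\<^bsub>K\<^esub> \<beta>) = F2 P \<alpha> \<star>\<^bsub>L\<^esub> F2 P \<beta>"

definition identity_on_objects ::
  "('o, 'a, 'b, 'x) cat2_scheme \<Rightarrow> ('o, 'c, 'd, 'y) cat2_scheme
    \<Rightarrow> ('o, 'a, 'b, 'o, 'c, 'd) func2 \<Rightarrow> bool" where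
  "identity_on_objects K L P \<longleftrightarrow>
     Obj (Hor K) = Obj (Hor L) \<and> (\<forall>X\<in>Obj (Hor K). F0 P X = X)"

definition faithful2 ::
  "('o, 'a, 'b, 'x) cat2_scheme \<Rightarrow> ('o, 'a, 'b, 'p, 'c, 'd) func2 \<Rightarrow> bool" where
  "faithful2 K P \<longleftrightarrow>
     faithful (Hor K) \<lparr>FO = F0 P, FA = F1 P\<rparr> \<and> faithful (Ver K) \<lparr>FO = F1 P, FA = F2 P\<rparr>"

locale preserves_monoidal_strictly =
  fixes K :: "('o, 'a, 'b, 'x) mcat2_scheme" and L :: "('p, 'c, 'd, 'y) mcat2_scheme"
    and P :: "('o, 'a, 'b, 'p, 'c, 'd) func2"
  assumes ten0:
      "\<lbrakk>X \<in> Obj (Hor K); Y \<in> Obj (Hor K)\<rbrakk> \<Longrightarrow> F0 P (Ten0 K X Y) = Ten0 L (F0 P X) (F0 P Y)"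
    and unit0: "F0 P (Unit0 K) = Unit0 L"
    and ten1:
      "\<lbrakk>f \<in> Arr (Hor K); g \<in> Arr (Hor K)\<rbrakk> \<Longrightarrow> F1 P (Ten1 K f g) = Ten1 L (F1 P f) (F1 P g)"
    and ten2:
      "\<lbrakk>\<alpha> \<in> Arr (Ver K); \<beta> \<in> Arr (Ver K)\<rbrakk> \<Longrightarrow> F2 P (Ten2 K \<alpha> \<beta>) = Ten2 L (F2 P \<alpha>) (F2 P \<beta>)"
    and inter:
      "\<lbrakk>f\<^sub>1 \<in> hom (Hor K) X\<^sub>1 Y\<^sub>1; g\<^sub>1 \<in> hom (Hor K) Y\<^sub>1 Z\<^sub>1;
        f\<^sub>2 \<in> hom (Hor K) X\<^sub>2 Y\<^sub>2; g\<^sub>2 \<in> hom (Hor K) Y\<^sub>2 Z\<^sub>2\<rbrakk>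
        \<Longrightarrow> F2 P (Inter K f\<^sub>1 g\<^sub>1 f\<^sub>2 g\<^sub>2) = Inter L (F1 P f\<^sub>1) (F1 P g\<^sub>1) (F1 P f\<^sub>2) (F1 P g\<^sub>2)"
    and assoc1:
      "\<lbrakk>X \<in> Obj (Hor K); Y \<in> Obj (Hor K); Z \<in> Obj (Hor K)\<rbrakk>
        \<Longrightarrow> F1 P (Assoc1 K X Y Z) = Assoc1 L (F0 P X) (F0 P Y) (F0 P Z)"
    and luni1: "X \<in> Obj (Hor K) \<Longrightarrow> F1 P (LUni1 K X) = LUni1 L (F0 P X)"
    and runi1: "X \<in> Obj (Hor K) \<Longrightarrow> F1 P (RUni1 K X) = RUni1 L (F0 P X)"

definition preserves_symmetry_strictly ::
  "('o, 'a, 'b, 'x) mcat2_scheme \<Rightarrow> ('p, 'c, 'd, 'y) mcat2_scheme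
    \<Rightarrow> ('o, 'a, 'b, 'p, 'c, 'd) func2 \<Rightarrow> bool" where
  "preserves_symmetry_strictly K L P \<longleftrightarrow>
     (\<forall>X\<in>Obj (Hor K). \<forall>Y\<in>Obj (Hor K). F1 P (Sym1 K X Y) = Sym1 L (F0 P X) (F0 P Y))"

text \<open>
  A monoidal category as a 2-category with only identity 2-cells: the identity 2-cell of a 1-cell is
  represented by that 1-cell itself.
\<close>

definition discrete2 :: "('o, 'a) smcat \<Rightarrow> ('o, 'a, 'a) mcat2" where
  "discrete2 C =
     \<lparr>Hor = cat.truncate C,
      Ver = \<lparr>Obj = Arr C, Arr = Arr C, Dom = \<lambda>f. f, Cod = \<lambda>f. f, Ide = \<lambda>f. f, Comp = \<lambda>f g. f\<rparr>,
      HComp = Comp C,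
      Ten0 = TenO C,
      Ten1 = TenA C,
      Ten2 = TenA C,
      Unit0 = Unit C,
      Assoc1 = Assoc C,
      LUni1 = LUni C,
      RUni1 = RUni C,
      Sym1 = Sym C,
      Inter = \<lambda>f\<^sub>1 g\<^sub>1 f\<^sub>2 g\<^sub>2. (f\<^sub>1 \<Zsemi>\<^bsub>C\<^esub> g\<^sub>1) \<otimes>\<^bsub>C\<^esub> (f\<^sub>2 \<Zsemi>\<^bsub>C\<^esub> g\<^sub>2)\<rparr>"

section \<open>The 2-category of parametric uncertain arrows\<close>

text \<open>
  The 1-cell \<open>(X, k, Y)\<close> is the Kleisli arrow \<open>k : A \<rightarrow> F C(X, Y)\<close> with \<open>A \<in> U\<close>, regarded as going
  from \<open>X\<close> to \<open>Y\<close>; the 2-cell \<open>(p, \<phi>, q)\<close> is the Kleisli arrow \<open>\<phi>\<close> regarded as going from the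
  1-cell \<open>p\<close> to the 1-cell \<open>q\<close>.
\<close>

type_synonym ('c, 'o, 'a) cell1 = "'c \<times> ('o \<times> 'a \<times> 'o) \<times> 'c"
type_synonym ('c, 'o, 'a) cell2 =
  "('c, 'o, 'a) cell1 \<times> ('o \<times> 'a \<times> 'o) \<times> ('c, 'o, 'a) cell1"

definition param_hor ::
  "('p, 'b, 'x) smcat_scheme \<Rightarrow> ('p, 'b) mon_monad \<Rightarrow> ('o, 'a, 'p, 'b) lax_func \<Rightarrow> 'p set
    \<Rightarrow> ('c, 'o, 'a, 'y) vcat_scheme \<Rightarrow> ('c, ('c, 'p, 'b) cell1) cat" where
  "param_hor W M F U C =
     \<lparr>Obj = VObj C,
      Arr = {(X, k, Y). X \<in> VObj C \<and> Y \<in> VObj C \<and>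
               (\<exists>A\<in>U. k \<in> hom (kleisli W M) A (FO F (VHom C X Y)))},
      Dom = \<lambda>(X, k, Y). X,
      Cod = \<lambda>(X, k, Y). Y,
      Ide = \<lambda>X. (X, FA (kl_functor W M) (VId (change_base W F C) X), X),
      Comp = \<lambda>(X, k, Y) (Y', k', Z).
        (X, (k \<otimes>\<^bsub>kleisli W M\<^esub> k')
              \<Zsemi>\<^bsub>kleisli W M\<^esub> FA (kl_functor W M) (VComp (change_base W F C) X Y Z), Z)\<rparr>"

definition param_ver ::
  "('p, 'b, 'x) smcat_scheme \<Rightarrow> ('p, 'b) mon_monad \<Rightarrow> ('o, 'a, 'p, 'b) lax_func \<Rightarrow> 'p set
    \<Rightarrow> ('c, 'o, 'a, 'y) vcat_scheme \<Rightarrow> (('c, 'p, 'b) cell1, ('c, 'p, 'b) cell2) cat" where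
  "param_ver W M F U C =
     \<lparr>Obj = Arr (param_hor W M F U C),
      Arr = {((X, k, Y), \<phi>, (X', k', Y')).
               (X, k, Y) \<in> Arr (param_hor W M F U C) \<and> (X', k', Y') \<in> Arr (param_hor W M F U C) \<and>
               X = X' \<and> Y = Y' \<and>
               \<phi> \<in> hom (kleisli W M) (Dom (kleisli W M) k) (Dom (kleisli W M) k') \<and>
               k = \<phi> \<Zsemi>\<^bsub>kleisli W M\<^esub> k'},
      Dom = \<lambda>(p, \<phi>, q). p,
      Cod = \<lambda>(p, \<phi>, q). q,
      Ide = \<lambda>(X, k, Y). ((X, k, Y), Ide (kleisli W M) (Dom (kleisli W M) k), (X, k, Y)),
      Comp = \<lambda>(p, \<phi>, q) (q', \<psi>, r). (p, \<phi> \<Zsemi>\<^bsub>kleisli W M\<^esub> \<psi>, r)\<rparr>"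

definition param_ten1 ::
  "('p, 'b, 'x) smcat_scheme \<Rightarrow> ('p, 'b) mon_monad \<Rightarrow> ('o, 'a, 'p, 'b) lax_func
    \<Rightarrow> ('c, 'o, 'a, 'y) mvcat_scheme
    \<Rightarrow> ('c, 'p, 'b) cell1 \<Rightarrow> ('c, 'p, 'b) cell1 \<Rightarrow> ('c, 'p, 'b) cell1" where
  "param_ten1 W M F C =
     (\<lambda>(X\<^sub>1, k\<^sub>1, Y\<^sub>1) (X\<^sub>2, k\<^sub>2, Y\<^sub>2).
        (VTenO C X\<^sub>1 X\<^sub>2,
         (k\<^sub>1 \<otimes>\<^bsub>kleisli W M\<^esub> k\<^sub>2)
           \<Zsemi>\<^bsub>kleisli W M\<^esub> FA (kl_functor W M)
             (LaxT F (VHom C X\<^sub>1 Y\<^sub>1) (VHom C X\<^sub>2 Y\<^sub>2) \<Zsemi>\<^bsub>W\<^esub> FA F (VTenA C X\<^sub>1 X\<^sub>2 Y\<^sub>1 Y\<^sub>2)),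
         VTenO C Y\<^sub>1 Y\<^sub>2))"

definition param_coh ::
  "('p, 'b, 'x) smcat_scheme \<Rightarrow> ('p, 'b) mon_monad \<Rightarrow> ('o, 'a, 'p, 'b) lax_func
    \<Rightarrow> 'a \<Rightarrow> 'p \<times> 'b \<times> 'p" where
  "param_coh W M F c = FA (kl_functor W M) (LaxU F \<Zsemi>\<^bsub>W\<^esub> FA F c)"

definition param2 ::
  "('p, 'b, 'x) smcat_scheme \<Rightarrow> ('p, 'b) mon_monad \<Rightarrow> ('o, 'a, 'p, 'b) lax_func \<Rightarrow> 'p set
    \<Rightarrow> ('c, 'o, 'a, 'y) mvcat_scheme
    \<Rightarrow> ('c, ('c, 'p, 'b) cell1, ('c, 'p, 'b) cell2) mcat2" where
  "param2 W M F U C =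
    (let Kl = kleisli W M;
         H = param_hor W M F U C;
         ten1 = param_ten1 W M F C;
         par = (\<lambda>(X, k, Y). Dom Kl k)
     in
     \<lparr>Hor = H,
      Ver = param_ver W M F U C,
      HComp = \<lambda>(p\<^sub>1, \<phi>\<^sub>1, q\<^sub>1) (p\<^sub>2, \<phi>\<^sub>2, q\<^sub>2). (p\<^sub>1 \<Zsemi>\<^bsub>H\<^esub> p\<^sub>2, \<phi>\<^sub>1 \<otimes>\<^bsub>Kl\<^esub> \<phi>\<^sub>2, q\<^sub>1 \<Zsemi>\<^bsub>H\<^esub> q\<^sub>2),
      Ten0 = VTenO C,
      Ten1 = ten1,
      Ten2 = \<lambda>(p\<^sub>1, \<phi>\<^sub>1, q\<^sub>1) (p\<^sub>2, \<phi>\<^sub>2, q\<^sub>2). (ten1 p\<^sub>1 p\<^sub>2, \<phi>\<^sub>1 \<otimes>\<^bsub>Kl\<^esub> \<phi>\<^sub>2, ten1 q\<^sub>1 q\<^sub>2),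
      Unit0 = VUnit C,
      Assoc1 = \<lambda>X Y Z.
        (VTenO C (VTenO C X Y) Z, param_coh W M F (VAssoc C X Y Z), VTenO C X (VTenO C Y Z)),
      LUni1 = \<lambda>X. (VTenO C (VUnit C) X, param_coh W M F (VLUni C X), X),
      RUni1 = \<lambda>X. (VTenO C X (VUnit C), param_coh W M F (VRUni C X), X),
      Sym1 = \<lambda>X Y. (VTenO C X Y, param_coh W M F (VSym C X Y), VTenO C Y X),
      Inter = \<lambda>f\<^sub>1 g\<^sub>1 f\<^sub>2 g\<^sub>2.
        (ten1 (f\<^sub>1 \<Zsemi>\<^bsub>H\<^esub> g\<^sub>1) (f\<^sub>2 \<Zsemi>\<^bsub>H\<^esub> g\<^sub>2),
         FA (kl_functor W M) (mid_exchange W (par f\<^sub>1) (par g\<^sub>1) (par f\<^sub>2) (par g\<^sub>2)),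
         ten1 f\<^sub>1 f\<^sub>2 \<Zsemi>\<^bsub>H\<^esub> ten1 g\<^sub>1 g\<^sub>2)\<rparr>)"

end

theory Submission
  imports Defs
begin

text \<open>
  The inclusion sends \<open>f : I \<rightarrow> C(X, Y)\<close> to the Kleisli arrow \<open>L\<^sub>M (F\<^sub>\<epsilon> ; F f)\<close> with trivial parameter object
  \<open>I\<^sub>W\<close>. Composition and monoidal product in \<open>C\<^sub>0\<close> start with \<open>l\<^sub>I\<^sup>-\<^sup>1 : I \<rightarrow> I \<odot> I\<close>, whereas in the target
  the parameter objects are tensored; the two agree since \<open>I\<^sub>W \<odot> I\<^sub>W = I\<^sub>W\<close> strictly in \<open>U\<close>, and the unit
  law of \<open>F\<close> then gives \<open>(F\<^sub>\<epsilon> \<otimes> F\<^sub>\<epsilon>) ; F\<^sup>~ = F\<^sub>\<epsilon> ; F (l\<^sub>I\<^sup>-\<^sup>1)\<close>. That the target is a strict 2-category follows because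
  \<open>F\<^sub>* C\<close> is a \<open>W\<close>-category, \<open>L\<^sub>M\<close> is strict monoidal, and the associators and unitors of the Kleisli
  category are identities on \<open>U\<close>. The inclusion is \<open>F\<^sub>*\<^sup>0\<close> followed by \<open>L\<^sub>M\<close> on hom-sets, whence the
  statement about faithfulness.
\<close>

section \<open>Categories and monoidal categories\<close>

context category
begin

lemma ide_simps [simp]:
  assumes "A \<in> Obj C"
  shows "Ide C A \<in> Arr C" "Dom C (Ide C A) = A" "Cod C (Ide C A) = A"
  using ide_hom[OF assms] by (auto simp: hom_def)

text \<open>In the axioms the intermediate objects occur only in the \<open>hom\<close> premises, so
  the simplifier cannot determine them. With membership in \<open>Arr\<close> and equations between
  \<open>Dom\<close> and \<open>Cod\<close> as side conditions the laws become usable rewrite rules;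
  the other structures below are treated the same way.\<close>

lemma comp_simps [simp]:
  assumes "f \<in> Arr C" "g \<in> Arr C" "Cod C f = Dom C g"
  shows "f \<Zsemi> g \<in> Arr C" "Dom C (f \<Zsemi> g) = Dom C f" "Cod C (f \<Zsemi> g) = Cod C g"
  using comp_hom[of f "Dom C f" "Cod C f" g "Cod C g"] assms by (auto simp: hom_def)

lemma ide_comp_arr [simp]: "\<lbrakk>f \<in> Arr C; Dom C f = A\<rbrakk> \<Longrightarrow> Ide C A \<Zsemi> f = f"
  by (rule ide_comp) (simp add: hom_def)

lemma comp_ide_arr [simp]: "\<lbrakk>f \<in> Arr C; Cod C f = B\<rbrakk> \<Longrightarrow> f \<Zsemi> Ide C B = f"
  by (rule comp_ide) (simp add: hom_def)

lemma comp_assoc_arr: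
  "\<lbrakk>f \<in> Arr C; g \<in> Arr C; h \<in> Arr C; Cod C f = Dom C g; Cod C g = Dom C h\<rbrakk>
    \<Longrightarrow> (f \<Zsemi> g) \<Zsemi> h = f \<Zsemi> (g \<Zsemi> h)"
  by (rule comp_assoc) (simp_all add: hom_def)

lemma obj_simps [simp]: "f \<in> Arr C \<Longrightarrow> Dom C f \<in> Obj C" "f \<in> Arr C \<Longrightarrow> Cod C f \<in> Obj C"
  by (simp_all add: dom_obj cod_obj)

text \<open>This gives the \<open>THE\<close> in the definition of \<open>inv_arr\<close> its
  meaning: any inverse that can be exhibited is the value of \<open>inv_arr\<close>.\<close>

lemma inverse_arrows_unique:
  assumes "inverse_arrows C f g" "inverse_arrows C f h"
  shows "g = h"
proof -
  have "g = g \<Zsemi> Ide C (Cod C g)" using assms by (simp add: inverse_arrows_def hom_def)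
  also have "\<dots> = g \<Zsemi> (f \<Zsemi> h)" using assms by (simp add: inverse_arrows_def hom_def)
  also have "\<dots> = (g \<Zsemi> f) \<Zsemi> h"
    by (rule comp_assoc_arr[symmetric]) (use assms in \<open>simp_all add: inverse_arrows_def hom_def\<close>)
  also have "\<dots> = h" using assms by (simp add: inverse_arrows_def hom_def)
  finally show ?thesis .
qed

lemma inv_arr_eq: "inverse_arrows C f g \<Longrightarrow> inv_arr C f = g"
  unfolding inv_arr_def using inverse_arrows_unique by blast

lemma inverse_arrows_inv_arr: "is_iso C f \<Longrightarrow> inverse_arrows C f (inv_arr C f)"
  unfolding is_iso_def using inv_arr_eq by blast

lemma inv_arr_ide: "A \<in> Obj C \<Longrightarrow> inv_arr C (Ide C A) = Ide C A"
  by (rule inv_arr_eq) (simp add: inverse_arrows_def hom_def)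

end

context monoidal_category
begin

lemma ten_simps [simp]:
  assumes "f \<in> Arr C" "g \<in> Arr C"
  shows "f \<otimes> g \<in> Arr C" "Dom C (f \<otimes> g) = Dom C f \<odot> Dom C g"
    "Cod C (f \<otimes> g) = Cod C f \<odot> Cod C g"
  using tenA[of f "Dom C f" "Cod C f" g "Dom C g" "Cod C g"] assms by (auto simp: hom_def)

lemma ten_comp_arr:
  "\<lbrakk>f \<in> Arr C; g \<in> Arr C; f' \<in> Arr C; g' \<in> Arr C; Cod C f = Dom C g; Cod C f' = Dom C g'\<rbrakk>
    \<Longrightarrow> (f \<otimes> f') \<Zsemi> (g \<otimes> g') = (f \<Zsemi> g) \<otimes> (f' \<Zsemi> g')"
  by (rule ten_comp[symmetric]) (simp_all add: hom_def)

text \<open>Composites are normally nested to the right, where two adjacent products are followed by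
  a further factor \<open>h\<close>. This form merges the products in that position.\<close>

lemma ten_comp_comp_arr:
  "\<lbrakk>f \<in> Arr C; g \<in> Arr C; f' \<in> Arr C; g' \<in> Arr C; Cod C f = Dom C g; Cod C f' = Dom C g';
    h \<in> Arr C; Dom C h = Cod C g \<odot> Cod C g'\<rbrakk>
    \<Longrightarrow> (f \<otimes> f') \<Zsemi> ((g \<otimes> g') \<Zsemi> h) = ((f \<Zsemi> g) \<otimes> (f' \<Zsemi> g')) \<Zsemi> h"
  by (simp add: ten_comp_arr flip: comp_assoc_arr)

lemma coh_simps [simp]:
  "\<lbrakk>A \<in> Obj C; B \<in> Obj C\<rbrakk> \<Longrightarrow> A \<odot> B \<in> Obj C"
  "Unit C \<in> Obj C"
  "\<lbrakk>A \<in> Obj C; B \<in> Obj C; D \<in> Obj C\<rbrakk> \<Longrightarrow> Assoc C A B D \<in> Arr C"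
  "\<lbrakk>A \<in> Obj C; B \<in> Obj C; D \<in> Obj C\<rbrakk> \<Longrightarrow> Dom C (Assoc C A B D) = (A \<odot> B) \<odot> D"
  "\<lbrakk>A \<in> Obj C; B \<in> Obj C; D \<in> Obj C\<rbrakk> \<Longrightarrow> Cod C (Assoc C A B D) = A \<odot> (B \<odot> D)"
  "A \<in> Obj C \<Longrightarrow> LUni C A \<in> Arr C"
  "A \<in> Obj C \<Longrightarrow> Dom C (LUni C A) = Unit C \<odot> A"
  "A \<in> Obj C \<Longrightarrow> Cod C (LUni C A) = A"
  "A \<in> Obj C \<Longrightarrow> RUni C A \<in> Arr C"
  "A \<in> Obj C \<Longrightarrow> Dom C (RUni C A) = A \<odot> Unit C"
  "A \<in> Obj C \<Longrightarrow> Cod C (RUni C A) = A"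
  using tenO unit assoc_hom[of A B D] luni_hom[of A] runi_hom[of A] by (auto simp: hom_def)

lemma assoc_nat_arr:
  "\<lbrakk>f \<in> Arr C; g \<in> Arr C; h \<in> Arr C\<rbrakk>
    \<Longrightarrow> ((f \<otimes> g) \<otimes> h) \<Zsemi> Assoc C (Cod C f) (Cod C g) (Cod C h)
      = Assoc C (Dom C f) (Dom C g) (Dom C h) \<Zsemi> (f \<otimes> (g \<otimes> h))"
  by (rule assoc_nat) (simp_all add: hom_def)

lemma luni_nat_arr: "f \<in> Arr C \<Longrightarrow> (Ide C (Unit C) \<otimes> f) \<Zsemi> LUni C (Cod C f) = LUni C (Dom C f) \<Zsemi> f"
  by (rule luni_nat) (simp add: hom_def)

lemma runi_nat_arr: "f \<in> Arr C \<Longrightarrow> (f \<otimes> Ide C (Unit C)) \<Zsemi> RUni C (Cod C f) = RUni C (Dom C f) \<Zsemi> f"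
  by (rule runi_nat) (simp add: hom_def)

text \<open>This inverse opens every composite and every product in the underlying category, because
  the product of two arrows out of \<open>I\<close> has to be precomposed with an arrow from
  \<open>I\<close> to \<open>I \<odot> I\<close>.\<close>

lemma inv_luni_unit [simp]:
  "inv_arr C (LUni C (Unit C)) \<in> Arr C"
  "Dom C (inv_arr C (LUni C (Unit C))) = Unit C"
  "Cod C (inv_arr C (LUni C (Unit C))) = Unit C \<odot> Unit C"
  "LUni C (Unit C) \<Zsemi> inv_arr C (LUni C (Unit C)) = Ide C (Unit C \<odot> Unit C)"
  using inverse_arrows_inv_arr[OF luni_iso[OF unit]]
  by (simp_all add: inverse_arrows_def hom_def)

end

context is_functor
begin

lemma arr_simps [simp]:
  assumes "f \<in> Arr C"
  shows "FA F f \<in> Arr D" "Dom D (FA F f) = FO F (Dom C f)" "Cod D (FA F f) = FO F (Cod C f)"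
  using arr[of f "Dom C f" "Cod C f"] assms by (auto simp: hom_def)

lemma comp_arr:
  "\<lbrakk>f \<in> Arr C; g \<in> Arr C; Cod C f = Dom C g\<rbrakk>
    \<Longrightarrow> FA F (f \<Zsemi>\<^bsub>C\<^esub> g) = FA F f \<Zsemi>\<^bsub>D\<^esub> FA F g"
  by (rule comp) (simp_all add: hom_def)

declare obj [simp]

text \<open>A functor sends inverses to inverses. This makes the coherence maps of the Kleisli
  category invertible, since they are images of those of \<open>W\<close>.\<close>

lemma preserves_iso:
  assumes "is_iso C f"
  shows "is_iso D (FA F f)"
proof -
  obtain g where "inverse_arrows C f g" using assms by (auto simp: is_iso_def)
  then have "inverse_arrows D (FA F f) (FA F g)"
    by (auto simp: inverse_arrows_def hom_def ide simp flip: comp_arr)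
  then show ?thesis by (auto simp: is_iso_def)
qed

end

section \<open>Change of base\<close>

context lax_symmetric_monoidal_functor
begin

lemma lax_simps [simp]:
  "LaxU F \<in> Arr W" "Dom W (LaxU F) = Unit W" "Cod W (LaxU F) = FO F (Unit V)"
  "\<lbrakk>A \<in> Obj V; B \<in> Obj V\<rbrakk> \<Longrightarrow> LaxT F A B \<in> Arr W"
  "\<lbrakk>A \<in> Obj V; B \<in> Obj V\<rbrakk> \<Longrightarrow> Dom W (LaxT F A B) = FO F A \<odot>\<^bsub>W\<^esub> FO F B"
  "\<lbrakk>A \<in> Obj V; B \<in> Obj V\<rbrakk> \<Longrightarrow> Cod W (LaxT F A B) = FO F (A \<odot>\<^bsub>V\<^esub> B)"
  using laxU_hom laxT_hom[of A B] by (auto simp: hom_def)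

lemma laxT_nat_arr:
  "\<lbrakk>f \<in> Arr V; g \<in> Arr V\<rbrakk>
    \<Longrightarrow> (FA F f \<otimes>\<^bsub>W\<^esub> FA F g) \<Zsemi>\<^bsub>W\<^esub> LaxT F (Cod V f) (Cod V g)
      = LaxT F (Dom V f) (Dom V g) \<Zsemi>\<^bsub>W\<^esub> FA F (f \<otimes>\<^bsub>V\<^esub> g)"
  by (rule laxT_nat) (simp_all add: hom_def)

text \<open>Composition after change of base is a comparison map followed by an image
  \<open>FA F h\<close>. Naturality moves a product of images through the comparison map, and
  functoriality joins it with \<open>h\<close>, so that the laws of \<open>C\<close> can be applied
  under \<open>F\<close>.\<close>

lemma laxT_nat_comp:
  assumes "f \<in> Arr V" "g \<in> Arr V" "h \<in> Arr V"
    "Cod V f = A" "Cod V g = B" "Dom V h = A \<odot>\<^bsub>V\<^esub> B"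
  shows "(FA F f \<otimes>\<^bsub>W\<^esub> FA F g) \<Zsemi>\<^bsub>W\<^esub> (LaxT F A B \<Zsemi>\<^bsub>W\<^esub> FA F h)
    = LaxT F (Dom V f) (Dom V g) \<Zsemi>\<^bsub>W\<^esub> FA F ((f \<otimes>\<^bsub>V\<^esub> g) \<Zsemi>\<^bsub>V\<^esub> h)"
proof -
  have "(FA F f \<otimes>\<^bsub>W\<^esub> FA F g) \<Zsemi>\<^bsub>W\<^esub> (LaxT F A B \<Zsemi>\<^bsub>W\<^esub> FA F h)
      = ((FA F f \<otimes>\<^bsub>W\<^esub> FA F g) \<Zsemi>\<^bsub>W\<^esub> LaxT F A B) \<Zsemi>\<^bsub>W\<^esub> FA F h"
    using assms by (auto simp: D.comp_assoc_arr)
  also have "(FA F f \<otimes>\<^bsub>W\<^esub> FA F g) \<Zsemi>\<^bsub>W\<^esub> LaxT F A B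
      = LaxT F (Dom V f) (Dom V g) \<Zsemi>\<^bsub>W\<^esub> FA F (f \<otimes>\<^bsub>V\<^esub> g)"
    using assms laxT_nat_arr by blast
  finally show ?thesis using assms by (auto simp: D.comp_assoc_arr comp_arr)
qed

end

section \<open>The laws of an enriched category after change of base\<close>

context
  fixes V :: "('o, 'a, 'x) smcat_scheme" and W :: "('p, 'b, 'y) smcat_scheme"
    and F :: "('o, 'a, 'p, 'b) lax_func" and C :: "('c, 'o, 'a, 'z) vcat_scheme"
  assumes F: "lax_symmetric_monoidal_functor V W F" and C: "vcategory V C"
begin

interpretation F: lax_symmetric_monoidal_functor V W F by (rule F)
interpretation C: vcategory V C by (rule C)

lemma vcat_simps [simp]:
  "\<lbrakk>X \<in> VObj C; Y \<in> VObj C\<rbrakk> \<Longrightarrow> VHom C X Y \<in> Obj V"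
  "\<lbrakk>X \<in> VObj C; Y \<in> VObj C; Z \<in> VObj C\<rbrakk> \<Longrightarrow> VComp C X Y Z \<in> Arr V"
  "\<lbrakk>X \<in> VObj C; Y \<in> VObj C; Z \<in> VObj C\<rbrakk>
    \<Longrightarrow> Dom V (VComp C X Y Z) = VHom C X Y \<odot>\<^bsub>V\<^esub> VHom C Y Z"
  "\<lbrakk>X \<in> VObj C; Y \<in> VObj C; Z \<in> VObj C\<rbrakk> \<Longrightarrow> Cod V (VComp C X Y Z) = VHom C X Z"
  "X \<in> VObj C \<Longrightarrow> VId C X \<in> Arr V"
  "X \<in> VObj C \<Longrightarrow> Dom V (VId C X) = Unit V"
  "X \<in> VObj C \<Longrightarrow> Cod V (VId C X) = VHom C X X"
  using C.vhom C.vcomp_hom[of X Y Z] C.vid_hom by (auto simp: hom_def)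

text \<open>The associativity law of \<open>C\<close> is applied under \<open>F\<close>; the image
  of the associator of \<open>V\<close> that it produces is exchanged for the associator of
  \<open>W\<close> by the associativity coherence of \<open>F\<close>. Naturality of the comparison
  map leads into this form and out of it again.\<close>

lemma change_base_assoc:
  assumes [simp]: "X \<in> VObj C" "Y \<in> VObj C" "Z \<in> VObj C" "T \<in> VObj C"
  defines "D \<equiv> change_base W F C"
  shows "(VComp D X Y Z \<otimes>\<^bsub>W\<^esub> Ide W (VHom D Z T)) \<Zsemi>\<^bsub>W\<^esub> VComp D X Z T
    = Assoc W (VHom D X Y) (VHom D Y Z) (VHom D Z T)
      \<Zsemi>\<^bsub>W\<^esub> (Ide W (VHom D X Y) \<otimes>\<^bsub>W\<^esub> VComp D Y Z T) \<Zsemi>\<^bsub>W\<^esub> VComp D X Y T"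
proof -
  let ?H = "VHom C" and ?c = "VComp C" and ?T = "LaxT F"
  have "(VComp D X Y Z \<otimes>\<^bsub>W\<^esub> Ide W (VHom D Z T)) \<Zsemi>\<^bsub>W\<^esub> VComp D X Z T
    = (?T (?H X Y) (?H Y Z) \<otimes>\<^bsub>W\<^esub> Ide W (FO F (?H Z T)))
      \<Zsemi>\<^bsub>W\<^esub> ((FA F (?c X Y Z) \<otimes>\<^bsub>W\<^esub> FA F (Ide V (?H Z T)))
        \<Zsemi>\<^bsub>W\<^esub> (?T (?H X Z) (?H Z T) \<Zsemi>\<^bsub>W\<^esub> FA F (?c X Z T)))"
    by (simp add: D_def change_base_def F.W.ten_comp_comp_arr F.ide)
  also have "\<dots> = (?T (?H X Y) (?H Y Z) \<otimes>\<^bsub>W\<^esub> Ide W (FO F (?H Z T)))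
      \<Zsemi>\<^bsub>W\<^esub> (?T (?H X Y \<odot>\<^bsub>V\<^esub> ?H Y Z) (?H Z T)
        \<Zsemi>\<^bsub>W\<^esub> FA F (Assoc V (?H X Y) (?H Y Z) (?H Z T)
          \<Zsemi>\<^bsub>V\<^esub> (Ide V (?H X Y) \<otimes>\<^bsub>V\<^esub> ?c Y Z T) \<Zsemi>\<^bsub>V\<^esub> ?c X Y T))"
    by (simp add: F.laxT_nat_comp C.vcomp_assoc)
  \<comment> \<open>Splitting off the image of the associator exposes the left side of
    \<open>lax_assoc\<close>.\<close>
  also have "\<dots> = ((?T (?H X Y) (?H Y Z) \<otimes>\<^bsub>W\<^esub> Ide W (FO F (?H Z T)))
      \<Zsemi>\<^bsub>W\<^esub> ?T (?H X Y \<odot>\<^bsub>V\<^esub> ?H Y Z) (?H Z T)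
        \<Zsemi>\<^bsub>W\<^esub> FA F (Assoc V (?H X Y) (?H Y Z) (?H Z T)))
          \<Zsemi>\<^bsub>W\<^esub> FA F ((Ide V (?H X Y) \<otimes>\<^bsub>V\<^esub> ?c Y Z T) \<Zsemi>\<^bsub>V\<^esub> ?c X Y T)"
    by (simp add: F.D.comp_assoc_arr F.C.comp_assoc_arr F.comp_arr)
  also have "\<dots> = Assoc W (FO F (?H X Y)) (FO F (?H Y Z)) (FO F (?H Z T))
      \<Zsemi>\<^bsub>W\<^esub> ((Ide W (FO F (?H X Y)) \<otimes>\<^bsub>W\<^esub> ?T (?H Y Z) (?H Z T))
        \<Zsemi>\<^bsub>W\<^esub> (?T (?H X Y) (?H Y Z \<odot>\<^bsub>V\<^esub> ?H Z T)
          \<Zsemi>\<^bsub>W\<^esub> FA F ((Ide V (?H X Y) \<otimes>\<^bsub>V\<^esub> ?c Y Z T) \<Zsemi>\<^bsub>V\<^esub> ?c X Y T)))"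
    by (subst F.lax_assoc) (simp_all add: F.D.comp_assoc_arr)
  also have "?T (?H X Y) (?H Y Z \<odot>\<^bsub>V\<^esub> ?H Z T)
          \<Zsemi>\<^bsub>W\<^esub> FA F ((Ide V (?H X Y) \<otimes>\<^bsub>V\<^esub> ?c Y Z T) \<Zsemi>\<^bsub>V\<^esub> ?c X Y T)
      = (FA F (Ide V (?H X Y)) \<otimes>\<^bsub>W\<^esub> FA F (?c Y Z T)) \<Zsemi>\<^bsub>W\<^esub> (?T (?H X Y) (?H Y T) \<Zsemi>\<^bsub>W\<^esub> FA F (?c X Y T))"
    by (simp add: F.laxT_nat_comp)
  finally show ?thesis
    by (simp add: D_def change_base_def F.W.ten_comp_comp_arr F.ide F.D.comp_assoc_arr)
qed

text \<open>Naturality of the comparison map brings \<open>vid_comp\<close> of \<open>C\<close>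
  under \<open>F\<close>, and what remains is the left unit law of \<open>F\<close>. The right unit
  law is obtained symmetrically.\<close>

lemma change_base_luni:
  assumes [simp]: "X \<in> VObj C" "Y \<in> VObj C"
  defines "D \<equiv> change_base W F C"
  shows "(VId D X \<otimes>\<^bsub>W\<^esub> Ide W (VHom D X Y)) \<Zsemi>\<^bsub>W\<^esub> VComp D X X Y = LUni W (VHom D X Y)"
proof -
  let ?H = "VHom C X Y"
  have "(VId D X \<otimes>\<^bsub>W\<^esub> Ide W (VHom D X Y)) \<Zsemi>\<^bsub>W\<^esub> VComp D X X Y
    = (LaxU F \<otimes>\<^bsub>W\<^esub> Ide W (FO F ?H)) \<Zsemi>\<^bsub>W\<^esub> ((FA F (VId C X) \<otimes>\<^bsub>W\<^esub> FA F (Ide V ?H))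
      \<Zsemi>\<^bsub>W\<^esub> (LaxT F (VHom C X X) ?H \<Zsemi>\<^bsub>W\<^esub> FA F (VComp C X X Y)))"
    by (simp add: D_def change_base_def F.W.ten_comp_comp_arr F.ide)
  also have "\<dots> = (LaxU F \<otimes>\<^bsub>W\<^esub> Ide W (FO F ?H)) \<Zsemi>\<^bsub>W\<^esub> (LaxT F (Unit V) ?H \<Zsemi>\<^bsub>W\<^esub> FA F (LUni V ?H))"
    by (simp add: F.laxT_nat_comp C.vid_comp)
  also have "\<dots> = LUni W (FO F ?H)"
    by (simp add: F.lax_luni flip: F.D.comp_assoc_arr)
  finally show ?thesis by (simp add: D_def change_base_def)
qed

lemma change_base_runi:
  assumes [simp]: "X \<in> VObj C" "Y \<in> VObj C"
  defines "D \<equiv> change_base W F C"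
  shows "(Ide W (VHom D X Y) \<otimes>\<^bsub>W\<^esub> VId D Y) \<Zsemi>\<^bsub>W\<^esub> VComp D X Y Y = RUni W (VHom D X Y)"
proof -
  let ?H = "VHom C X Y"
  have "(Ide W (VHom D X Y) \<otimes>\<^bsub>W\<^esub> VId D Y) \<Zsemi>\<^bsub>W\<^esub> VComp D X Y Y
    = (Ide W (FO F ?H) \<otimes>\<^bsub>W\<^esub> LaxU F) \<Zsemi>\<^bsub>W\<^esub> ((FA F (Ide V ?H) \<otimes>\<^bsub>W\<^esub> FA F (VId C Y))
      \<Zsemi>\<^bsub>W\<^esub> (LaxT F ?H (VHom C Y Y) \<Zsemi>\<^bsub>W\<^esub> FA F (VComp C X Y Y)))"
    by (simp add: D_def change_base_def F.W.ten_comp_comp_arr F.ide)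
  also have "\<dots> = (Ide W (FO F ?H) \<otimes>\<^bsub>W\<^esub> LaxU F) \<Zsemi>\<^bsub>W\<^esub> (LaxT F ?H (Unit V) \<Zsemi>\<^bsub>W\<^esub> FA F (RUni V ?H))"
    by (simp add: F.laxT_nat_comp C.vcomp_id)
  also have "\<dots> = RUni W (FO F ?H)"
    by (simp add: F.lax_runi flip: F.D.comp_assoc_arr)
  finally show ?thesis by (simp add: D_def change_base_def)
qed

lemma vcategory_change_base: "vcategory W (change_base W F C)"
proof
  fix X Y Z T
  assume X: "X \<in> VObj (change_base W F C)" and Y: "Y \<in> VObj (change_base W F C)"
  then have [simp]: "X \<in> VObj C" "Y \<in> VObj C" by (simp_all add: change_base_def)
  show "VHom (change_base W F C) X Y \<in> Obj W" by (simp add: change_base_def)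
  show "VId (change_base W F C) X \<in> hom W (Unit W) (VHom (change_base W F C) X X)"
    by (simp add: change_base_def hom_def)
  show "(VId (change_base W F C) X \<otimes>\<^bsub>W\<^esub> Ide W (VHom (change_base W F C) X Y))
      \<Zsemi>\<^bsub>W\<^esub> VComp (change_base W F C) X X Y = LUni W (VHom (change_base W F C) X Y)"
    by (simp add: change_base_luni)
  show "(Ide W (VHom (change_base W F C) X Y) \<otimes>\<^bsub>W\<^esub> VId (change_base W F C) Y)
      \<Zsemi>\<^bsub>W\<^esub> VComp (change_base W F C) X Y Y = RUni W (VHom (change_base W F C) X Y)"
    by (simp add: change_base_runi)
  assume Z: "Z \<in> VObj (change_base W F C)"
  then have [simp]: "Z \<in> VObj C" by (simp add: change_base_def)
  show "VComp (change_base W F C) X Y Z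
      \<in> hom W (VHom (change_base W F C) X Y \<odot>\<^bsub>W\<^esub> VHom (change_base W F C) Y Z)
          (VHom (change_base W F C) X Z)"
    by (simp add: change_base_def hom_def)
  assume "T \<in> VObj (change_base W F C)"
  then have [simp]: "T \<in> VObj C" by (simp add: change_base_def)
  show "(VComp (change_base W F C) X Y Z \<otimes>\<^bsub>W\<^esub> Ide W (VHom (change_base W F C) Z T))
      \<Zsemi>\<^bsub>W\<^esub> VComp (change_base W F C) X Z T
    = Assoc W (VHom (change_base W F C) X Y) (VHom (change_base W F C) Y Z) (VHom (change_base W F C) Z T)
      \<Zsemi>\<^bsub>W\<^esub> (Ide W (VHom (change_base W F C) X Y) \<otimes>\<^bsub>W\<^esub> VComp (change_base W F C) Y Z T)
      \<Zsemi>\<^bsub>W\<^esub> VComp (change_base W F C) X Y T"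
    by (simp add: change_base_assoc)
qed

end

section \<open>The Kleisli category\<close>


lemma kleisli_sel:
  "Obj (kleisli W M) = Obj W"
  "(A, f, B) \<in> Arr (kleisli W M)
    \<longleftrightarrow> A \<in> Obj W \<and> B \<in> Obj W \<and> f \<in> Arr W \<and> Dom W f = A \<and> Cod W f = FO M B"
  "Dom (kleisli W M) (A, f, B) = A"
  "Cod (kleisli W M) (A, f, B) = B"
  "Ide (kleisli W M) A = (A, Eta M A, A)"
  "(A, f, B) \<Zsemi>\<^bsub>kleisli W M\<^esub> (B', g, D) = (A, f \<Zsemi>\<^bsub>W\<^esub> FA M g \<Zsemi>\<^bsub>W\<^esub> Mult M D, D)"
  "A \<odot>\<^bsub>kleisli W M\<^esub> B = A \<odot>\<^bsub>W\<^esub> B"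
  "(A, f, X) \<otimes>\<^bsub>kleisli W M\<^esub> (B, g, Y) = (A \<odot>\<^bsub>W\<^esub> B, (f \<otimes>\<^bsub>W\<^esub> g) \<Zsemi>\<^bsub>W\<^esub> Nabla M X Y, X \<odot>\<^bsub>W\<^esub> Y)"
  "Unit (kleisli W M) = Unit W"
  "Assoc (kleisli W M) A B D = FA (kl_functor W M) (Assoc W A B D)"
  "LUni (kleisli W M) A = FA (kl_functor W M) (LUni W A)"
  "RUni (kleisli W M) A = FA (kl_functor W M) (RUni W A)"
  by (auto simp: kleisli_def hom_def)

lemma kl_functor_sel:
  "FO (kl_functor W M) A = A"
  "FA (kl_functor W M) f = (Dom W f, f \<Zsemi>\<^bsub>W\<^esub> Eta M (Cod W f), Cod W f)"
  by (simp_all add: kl_functor_def)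

lemma hom_kleisliE:
  assumes "k \<in> hom (kleisli W M) A B"
  obtains f where "k = (A, f, B)" "f \<in> Arr W" "Dom W f = A" "Cod W f = FO M B" "A \<in> Obj W" "B \<in> Obj W"
  using assms by (cases k) (auto simp: hom_def kleisli_sel)

section \<open>The monad laws and composition with arrows of the base\<close>

context symmetric_monoidal_monad
begin

lemmas W_assoc = lax.C.comp_assoc_arr

text \<open>The locale states its axioms for the lax functors \<open>monad_lax\<close>,
  \<open>comp_lax\<close> and \<open>id_lax\<close>; this lemma and the following ones read them off
  for the fields of \<open>M\<close> itself.\<close>

lemma monad_simps [simp]:
  "A \<in> Obj W \<Longrightarrow> FO M A \<in> Obj W"
  "f \<in> Arr W \<Longrightarrow> FA M f \<in> Arr W"
  "f \<in> Arr W \<Longrightarrow> Dom W (FA M f) = FO M (Dom W f)"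
  "f \<in> Arr W \<Longrightarrow> Cod W (FA M f) = FO M (Cod W f)"
  "A \<in> Obj W \<Longrightarrow> FA M (Ide W A) = Ide W (FO M A)"
  "A \<in> Obj W \<Longrightarrow> Eta M A \<in> Arr W"
  "A \<in> Obj W \<Longrightarrow> Dom W (Eta M A) = A"
  "A \<in> Obj W \<Longrightarrow> Cod W (Eta M A) = FO M A"
  "A \<in> Obj W \<Longrightarrow> Mult M A \<in> Arr W"
  "A \<in> Obj W \<Longrightarrow> Dom W (Mult M A) = FO M (FO M A)"
  "A \<in> Obj W \<Longrightarrow> Cod W (Mult M A) = FO M A"
  "\<lbrakk>A \<in> Obj W; B \<in> Obj W\<rbrakk> \<Longrightarrow> Nabla M A B \<in> Arr W"
  "\<lbrakk>A \<in> Obj W; B \<in> Obj W\<rbrakk> \<Longrightarrow> Dom W (Nabla M A B) = FO M A \<odot>\<^bsub>W\<^esub> FO M B"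
  "\<lbrakk>A \<in> Obj W; B \<in> Obj W\<rbrakk> \<Longrightarrow> Cod W (Nabla M A B) = FO M (A \<odot>\<^bsub>W\<^esub> B)"
  using lax.obj[of A] lax.arr_simps[of f] lax.ide[of A] eta.component[of A] mult.component[of A]
    lax.lax_simps(4-6)[of A B]
  by (auto simp: monad_lax_def comp_lax_def id_lax_def hom_def)

lemma map_comp:
  "\<lbrakk>f \<in> Arr W; g \<in> Arr W; Cod W f = Dom W g\<rbrakk>
    \<Longrightarrow> FA M (f \<Zsemi>\<^bsub>W\<^esub> g) = FA M f \<Zsemi>\<^bsub>W\<^esub> FA M g"
  using lax.comp_arr[of f g] by (simp add: monad_lax_def)

lemma eta_nat: "f \<in> Arr W \<Longrightarrow> f \<Zsemi>\<^bsub>W\<^esub> Eta M (Cod W f) = Eta M (Dom W f) \<Zsemi>\<^bsub>W\<^esub> FA M f"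
  using eta.natural[of f "Dom W f" "Cod W f"] by (simp add: monad_lax_def id_lax_def hom_def)

lemma mult_nat:
  "f \<in> Arr W \<Longrightarrow> FA M (FA M f) \<Zsemi>\<^bsub>W\<^esub> Mult M (Cod W f) = Mult M (Dom W f) \<Zsemi>\<^bsub>W\<^esub> FA M f"
  using mult.natural[of f "Dom W f" "Cod W f"] by (simp add: monad_lax_def comp_lax_def hom_def)

lemma nabla_nat:
  "\<lbrakk>f \<in> Arr W; g \<in> Arr W\<rbrakk>
    \<Longrightarrow> (FA M f \<otimes>\<^bsub>W\<^esub> FA M g) \<Zsemi>\<^bsub>W\<^esub> Nabla M (Cod W f) (Cod W g)
      = Nabla M (Dom W f) (Dom W g) \<Zsemi>\<^bsub>W\<^esub> FA M (f \<otimes>\<^bsub>W\<^esub> g)"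
  using lax.laxT_nat_arr[of f g] by (simp add: monad_lax_def)

lemma eta_nabla:
  "\<lbrakk>A \<in> Obj W; B \<in> Obj W\<rbrakk> \<Longrightarrow> (Eta M A \<otimes>\<^bsub>W\<^esub> Eta M B) \<Zsemi>\<^bsub>W\<^esub> Nabla M A B = Eta M (A \<odot>\<^bsub>W\<^esub> B)"
  using eta.mon_ten[of A B] by (simp add: monad_lax_def id_lax_def)

text \<open>The comparison map of \<open>M\<close> followed by \<open>M\<close> is
  \<open>Nabla\<close> followed by the image of \<open>Nabla\<close> under \<open>M\<close>. The
  equation is therefore the condition that \<mu> is monoidal, with its right side nested to the
  right.\<close>

lemma mult_nabla:
  "\<lbrakk>A \<in> Obj W; B \<in> Obj W\<rbrakk>
    \<Longrightarrow> (Mult M A \<otimes>\<^bsub>W\<^esub> Mult M B) \<Zsemi>\<^bsub>W\<^esub> Nabla M A B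
      = Nabla M (FO M A) (FO M B) \<Zsemi>\<^bsub>W\<^esub> (FA M (Nabla M A B) \<Zsemi>\<^bsub>W\<^esub> Mult M (A \<odot>\<^bsub>W\<^esub> B))"
  using mult.mon_ten[of A B] by (simp add: monad_lax_def comp_lax_def W_assoc)

lemma nabla_assoc:
  "\<lbrakk>A \<in> Obj W; B \<in> Obj W; D \<in> Obj W\<rbrakk>
    \<Longrightarrow> (Nabla M A B \<otimes>\<^bsub>W\<^esub> Ide W (FO M D))
        \<Zsemi>\<^bsub>W\<^esub> (Nabla M (A \<odot>\<^bsub>W\<^esub> B) D \<Zsemi>\<^bsub>W\<^esub> FA M (Assoc W A B D))
      = Assoc W (FO M A) (FO M B) (FO M D)
        \<Zsemi>\<^bsub>W\<^esub> ((Ide W (FO M A) \<otimes>\<^bsub>W\<^esub> Nabla M B D) \<Zsemi>\<^bsub>W\<^esub> Nabla M A (B \<odot>\<^bsub>W\<^esub> D))"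
  using lax.lax_assoc[of A B D] by (simp add: monad_lax_def W_assoc)

lemma nabla_luni:
  "A \<in> Obj W
    \<Longrightarrow> (Eta M (Unit W) \<otimes>\<^bsub>W\<^esub> Ide W (FO M A)) \<Zsemi>\<^bsub>W\<^esub> (Nabla M (Unit W) A \<Zsemi>\<^bsub>W\<^esub> FA M (LUni W A))
      = LUni W (FO M A)"
  using lax.lax_luni[of A] by (simp add: monad_lax_def W_assoc)

lemma nabla_runi:
  "A \<in> Obj W
    \<Longrightarrow> (Ide W (FO M A) \<otimes>\<^bsub>W\<^esub> Eta M (Unit W)) \<Zsemi>\<^bsub>W\<^esub> (Nabla M A (Unit W) \<Zsemi>\<^bsub>W\<^esub> FA M (RUni W A))
      = RUni W (FO M A)"
  using lax.lax_runi[of A] by (simp add: monad_lax_def W_assoc)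

lemma eta_nat_comp:
  "\<lbrakk>f \<in> Arr W; h \<in> Arr W; Cod W f = B; Dom W h = FO M B\<rbrakk>
    \<Longrightarrow> f \<Zsemi>\<^bsub>W\<^esub> (Eta M B \<Zsemi>\<^bsub>W\<^esub> h) = Eta M (Dom W f) \<Zsemi>\<^bsub>W\<^esub> (FA M f \<Zsemi>\<^bsub>W\<^esub> h)"
  using eta_nat[of f] by (auto simp flip: W_assoc)

text \<open>Naturality moves \<eta> past \<open>g\<close>, where the law \<open>eta_mult\<close>
  cancels it against \<mu>. Hence composing on the left with an arrow coming from \<open>W\<close>
  is plain composition in \<open>W\<close>.\<close>

lemma kl_functor_comp:
  assumes "f \<in> Arr W" "(Cod W f, g, D) \<in> Arr (kleisli W M)"
  shows "FA (kl_functor W M) f \<Zsemi>\<^bsub>kleisli W M\<^esub> (Cod W f, g, D) = (Dom W f, f \<Zsemi>\<^bsub>W\<^esub> g, D)"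
proof -
  have *: "g \<in> Arr W" "Dom W g = Cod W f" "Cod W g = FO M D" "D \<in> Obj W"
    using assms(2) by (auto simp: kleisli_sel)
  have "Eta M (Cod W f) \<Zsemi>\<^bsub>W\<^esub> (FA M g \<Zsemi>\<^bsub>W\<^esub> Mult M D) = g \<Zsemi>\<^bsub>W\<^esub> (Eta M (FO M D) \<Zsemi>\<^bsub>W\<^esub> Mult M D)"
    using * assms(1) eta_nat_comp[of g "Mult M D" "FO M D"] by simp
  then show ?thesis using * assms(1) by (simp add: kleisli_sel kl_functor_sel W_assoc eta_mult)
qed

text \<open>Here \<eta> occurs under \<open>FA M\<close>, and the other unit law,
  \<open>map_eta_mult\<close>, cancels it against \<mu>.\<close>

lemma comp_kl_functor:
  assumes "g \<in> Arr W" "(A, f, Dom W g) \<in> Arr (kleisli W M)"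
  shows "(A, f, Dom W g) \<Zsemi>\<^bsub>kleisli W M\<^esub> FA (kl_functor W M) g = (A, f \<Zsemi>\<^bsub>W\<^esub> FA M g, Cod W g)"
  using assms by (auto simp: kleisli_sel kl_functor_sel W_assoc map_comp map_eta_mult)

lemma category_kleisli: "category (kleisli W M)"
proof
  fix A f
  assume "f \<in> Arr (kleisli W M)"
  then show "Dom (kleisli W M) f \<in> Obj (kleisli W M)" "Cod (kleisli W M) f \<in> Obj (kleisli W M)"
    by (cases f; simp add: kleisli_sel)+
next
  fix A assume "A \<in> Obj (kleisli W M)"
  then show "Ide (kleisli W M) A \<in> hom (kleisli W M) A A" by (simp add: kleisli_sel hom_def)
next
  fix f A B assume f: "f \<in> hom (kleisli W M) A B"
  show "Ide (kleisli W M) A \<Zsemi>\<^bsub>kleisli W M\<^esub> f = f"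
    by (rule hom_kleisliE[OF f]) (use kl_functor_comp[of "Ide W A"] in \<open>auto simp: kleisli_sel kl_functor_sel\<close>)
  show "f \<Zsemi>\<^bsub>kleisli W M\<^esub> Ide (kleisli W M) B = f"
    by (rule hom_kleisliE[OF f]) (use comp_kl_functor[of "Ide W B" A] in \<open>auto simp: kleisli_sel kl_functor_sel\<close>)
  fix g D assume g: "g \<in> hom (kleisli W M) B D"
  show "f \<Zsemi>\<^bsub>kleisli W M\<^esub> g \<in> hom (kleisli W M) A D"
    by (rule hom_kleisliE[OF f], rule hom_kleisliE[OF g]) (simp add: kleisli_sel hom_def)
  fix h E assume h: "h \<in> hom (kleisli W M) D E"
  show "(f \<Zsemi>\<^bsub>kleisli W M\<^esub> g) \<Zsemi>\<^bsub>kleisli W M\<^esub> h = f \<Zsemi>\<^bsub>kleisli W M\<^esub> (g \<Zsemi>\<^bsub>kleisli W M\<^esub> h)"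
  proof (rule hom_kleisliE[OF f], rule hom_kleisliE[OF g], rule hom_kleisliE[OF h])
    fix f' g' h'
    assume *: "f = (A, f', B)" "f' \<in> Arr W" "Dom W f' = A" "Cod W f' = FO M B"
      "g = (B, g', D)" "g' \<in> Arr W" "Dom W g' = B" "Cod W g' = FO M D"
      "h = (D, h', E)" "h' \<in> Arr W" "Dom W h' = D" "Cod W h' = FO M E"
      "A \<in> Obj W" "B \<in> Obj W" "D \<in> Obj W" "E \<in> Obj W"
    \<comment> \<open>Both bracketings begin with \<open>f'\<close> followed by
      \<open>FA M g'\<close>; this is the equation between the remaining factors.\<close>
    have "FA M (FA M h') \<Zsemi>\<^bsub>W\<^esub> (FA M (Mult M E) \<Zsemi>\<^bsub>W\<^esub> Mult M E)
        = (FA M (FA M h') \<Zsemi>\<^bsub>W\<^esub> Mult M (FO M E)) \<Zsemi>\<^bsub>W\<^esub> Mult M E"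
      using * by (simp add: mult_assoc W_assoc)
    also have "\<dots> = Mult M D \<Zsemi>\<^bsub>W\<^esub> (FA M h' \<Zsemi>\<^bsub>W\<^esub> Mult M E)"
      using * mult_nat[of h'] by (simp add: W_assoc)
    finally show ?thesis using * by (simp add: kleisli_sel W_assoc map_comp)
  qed
qed

lemma is_functor_kl_functor: "is_functor W (kleisli W M) (kl_functor W M)"
proof (intro is_functor.intro is_functor_axioms.intro)
  show "category W" by (rule lax.C.category_axioms)
  show "category (kleisli W M)" by (rule category_kleisli)
next
  fix A assume "A \<in> Obj W"
  then show "FO (kl_functor W M) A \<in> Obj (kleisli W M)"
    "FA (kl_functor W M) (Ide W A) = Ide (kleisli W M) (FO (kl_functor W M) A)"
    by (simp_all add: kleisli_sel kl_functor_sel)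
next
  fix f A B assume f: "f \<in> hom W A B"
  then show "FA (kl_functor W M) f \<in> hom (kleisli W M) (FO (kl_functor W M) A) (FO (kl_functor W M) B)"
    by (auto simp: kleisli_sel kl_functor_sel hom_def)
  fix g E assume "g \<in> hom W B E"
  with f show "FA (kl_functor W M) (f \<Zsemi>\<^bsub>W\<^esub> g)
      = FA (kl_functor W M) f \<Zsemi>\<^bsub>kleisli W M\<^esub> FA (kl_functor W M) g"
    using kl_functor_comp[of f "g \<Zsemi>\<^bsub>W\<^esub> Eta M E" E]
    by (auto simp: kleisli_sel kl_functor_sel hom_def W_assoc)
qed

sublocale L: is_functor W "kleisli W M" "kl_functor W M"
  by (rule is_functor_kl_functor)

lemma ide_kleisli: "A \<in> Obj W \<Longrightarrow> Ide (kleisli W M) A = FA (kl_functor W M) (Ide W A)"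
  by (simp add: kleisli_sel kl_functor_sel)

text \<open>Both factors end in \<eta>, and since \<eta> is monoidal, \<open>Nabla\<close> merges
  the two occurrences into one. Together with functoriality this transports every equation between
  coherence maps from \<open>W\<close> to the Kleisli category.\<close>

lemma kl_functor_ten:
  assumes "f \<in> Arr W" "g \<in> Arr W"
  shows "FA (kl_functor W M) (f \<otimes>\<^bsub>W\<^esub> g)
    = FA (kl_functor W M) f \<otimes>\<^bsub>kleisli W M\<^esub> FA (kl_functor W M) g"
proof -
  have "((f \<Zsemi>\<^bsub>W\<^esub> Eta M (Cod W f)) \<otimes>\<^bsub>W\<^esub> (g \<Zsemi>\<^bsub>W\<^esub> Eta M (Cod W g))) \<Zsemi>\<^bsub>W\<^esub> Nabla M (Cod W f) (Cod W g)
    = (f \<otimes>\<^bsub>W\<^esub> g) \<Zsemi>\<^bsub>W\<^esub> ((Eta M (Cod W f) \<otimes>\<^bsub>W\<^esub> Eta M (Cod W g)) \<Zsemi>\<^bsub>W\<^esub> Nabla M (Cod W f) (Cod W g))"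
    using assms by (simp add: lax.V.ten_comp_comp_arr)
  then show ?thesis using assms by (simp add: kleisli_sel kl_functor_sel eta_nabla)
qed

section \<open>The monoidal structure of the Kleisli category\<close>

lemma kleisli_ten_comp:
  assumes f: "f \<in> hom (kleisli W M) A B" and g: "g \<in> hom (kleisli W M) B D"
    and f': "f' \<in> hom (kleisli W M) A' B'" and g': "g' \<in> hom (kleisli W M) B' D'"
  shows "(f \<Zsemi>\<^bsub>kleisli W M\<^esub> g) \<otimes>\<^bsub>kleisli W M\<^esub> (f' \<Zsemi>\<^bsub>kleisli W M\<^esub> g')
    = (f \<otimes>\<^bsub>kleisli W M\<^esub> f') \<Zsemi>\<^bsub>kleisli W M\<^esub> (g \<otimes>\<^bsub>kleisli W M\<^esub> g')"
proof (rule hom_kleisliE[OF f], rule hom_kleisliE[OF g], rule hom_kleisliE[OF f'], rule hom_kleisliE[OF g'])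
  fix h k h' k'
  assume *: "f = (A, h, B)" "h \<in> Arr W" "Dom W h = A" "Cod W h = FO M B"
    "g = (B, k, D)" "k \<in> Arr W" "Dom W k = B" "Cod W k = FO M D"
    "f' = (A', h', B')" "h' \<in> Arr W" "Dom W h' = A'" "Cod W h' = FO M B'"
    "g' = (B', k', D')" "k' \<in> Arr W" "Dom W k' = B'" "Cod W k' = FO M D'"
    "A \<in> Obj W" "B \<in> Obj W" "D \<in> Obj W" "A' \<in> Obj W" "B' \<in> Obj W" "D' \<in> Obj W"
  let ?N = "Nabla M"
  have "((h \<Zsemi>\<^bsub>W\<^esub> FA M k \<Zsemi>\<^bsub>W\<^esub> Mult M D) \<otimes>\<^bsub>W\<^esub> (h' \<Zsemi>\<^bsub>W\<^esub> FA M k' \<Zsemi>\<^bsub>W\<^esub> Mult M D')) \<Zsemi>\<^bsub>W\<^esub> ?N D D'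
    = (h \<otimes>\<^bsub>W\<^esub> h') \<Zsemi>\<^bsub>W\<^esub> ((FA M k \<otimes>\<^bsub>W\<^esub> FA M k') \<Zsemi>\<^bsub>W\<^esub> ((Mult M D \<otimes>\<^bsub>W\<^esub> Mult M D') \<Zsemi>\<^bsub>W\<^esub> ?N D D'))"
    using * by (simp add: lax.V.ten_comp_comp_arr W_assoc)
  also have "\<dots> = (h \<otimes>\<^bsub>W\<^esub> h') \<Zsemi>\<^bsub>W\<^esub> (((FA M k \<otimes>\<^bsub>W\<^esub> FA M k') \<Zsemi>\<^bsub>W\<^esub> ?N (FO M D) (FO M D'))
      \<Zsemi>\<^bsub>W\<^esub> (FA M (?N D D') \<Zsemi>\<^bsub>W\<^esub> Mult M (D \<odot>\<^bsub>W\<^esub> D')))"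
    using * by (simp add: mult_nabla W_assoc)
  also have "(FA M k \<otimes>\<^bsub>W\<^esub> FA M k') \<Zsemi>\<^bsub>W\<^esub> ?N (FO M D) (FO M D') = ?N B B' \<Zsemi>\<^bsub>W\<^esub> FA M (k \<otimes>\<^bsub>W\<^esub> k')"
    using * nabla_nat[of k k'] by simp
  finally show ?thesis using * by (simp add: kleisli_sel W_assoc map_comp)
qed

text \<open>By \<open>kl_functor_comp\<close> and \<open>comp_kl_functor\<close> both sides reduce
  to composites in \<open>W\<close>. There the associativity coherence of \<open>Nabla\<close> turns
  the image of the associator under \<open>M\<close> into an associator on the values of
  \<open>M\<close>, and naturality moves that one to the front.\<close>

lemma kleisli_assoc_nat:
  assumes f: "f \<in> hom (kleisli W M) A A'" and g: "g \<in> hom (kleisli W M) B B'"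
    and h: "h \<in> hom (kleisli W M) D D'"
  shows "((f \<otimes>\<^bsub>kleisli W M\<^esub> g) \<otimes>\<^bsub>kleisli W M\<^esub> h) \<Zsemi>\<^bsub>kleisli W M\<^esub> Assoc (kleisli W M) A' B' D'
    = Assoc (kleisli W M) A B D \<Zsemi>\<^bsub>kleisli W M\<^esub> (f \<otimes>\<^bsub>kleisli W M\<^esub> (g \<otimes>\<^bsub>kleisli W M\<^esub> h))"
proof (rule hom_kleisliE[OF f], rule hom_kleisliE[OF g], rule hom_kleisliE[OF h])
  fix k l m
  assume *: "f = (A, k, A')" "k \<in> Arr W" "Dom W k = A" "Cod W k = FO M A'"
    "g = (B, l, B')" "l \<in> Arr W" "Dom W l = B" "Cod W l = FO M B'"
    "h = (D, m, D')" "m \<in> Arr W" "Dom W m = D" "Cod W m = FO M D'"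
    "A \<in> Obj W" "B \<in> Obj W" "D \<in> Obj W" "A' \<in> Obj W" "B' \<in> Obj W" "D' \<in> Obj W"
  let ?N = "Nabla M"
  have "(((k \<otimes>\<^bsub>W\<^esub> l) \<Zsemi>\<^bsub>W\<^esub> ?N A' B') \<otimes>\<^bsub>W\<^esub> m) \<Zsemi>\<^bsub>W\<^esub> (?N (A' \<odot>\<^bsub>W\<^esub> B') D' \<Zsemi>\<^bsub>W\<^esub> FA M (Assoc W A' B' D'))
    = ((k \<otimes>\<^bsub>W\<^esub> l) \<otimes>\<^bsub>W\<^esub> m) \<Zsemi>\<^bsub>W\<^esub> ((?N A' B' \<otimes>\<^bsub>W\<^esub> Ide W (FO M D'))
      \<Zsemi>\<^bsub>W\<^esub> (?N (A' \<odot>\<^bsub>W\<^esub> B') D' \<Zsemi>\<^bsub>W\<^esub> FA M (Assoc W A' B' D')))"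
    using * by (simp add: lax.V.ten_comp_comp_arr)
  also have "\<dots> = (((k \<otimes>\<^bsub>W\<^esub> l) \<otimes>\<^bsub>W\<^esub> m) \<Zsemi>\<^bsub>W\<^esub> Assoc W (FO M A') (FO M B') (FO M D'))
      \<Zsemi>\<^bsub>W\<^esub> ((Ide W (FO M A') \<otimes>\<^bsub>W\<^esub> ?N B' D') \<Zsemi>\<^bsub>W\<^esub> ?N A' (B' \<odot>\<^bsub>W\<^esub> D'))"
    using * by (simp add: nabla_assoc W_assoc)
  also have "\<dots> = Assoc W A B D \<Zsemi>\<^bsub>W\<^esub> ((k \<otimes>\<^bsub>W\<^esub> ((l \<otimes>\<^bsub>W\<^esub> m) \<Zsemi>\<^bsub>W\<^esub> ?N B' D')) \<Zsemi>\<^bsub>W\<^esub> ?N A' (B' \<odot>\<^bsub>W\<^esub> D'))"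
    using * lax.V.assoc_nat_arr[of k l m] by (simp add: W_assoc lax.V.ten_comp_comp_arr)
  finally show ?thesis
    using * comp_kl_functor[of "Assoc W A' B' D'" "(A \<odot>\<^bsub>W\<^esub> B) \<odot>\<^bsub>W\<^esub> D"]
      kl_functor_comp[of "Assoc W A B D"]
    by (simp add: kleisli_sel W_assoc)
qed

text \<open>The identity of the unit object is \<eta>, which is also the unit comparison of
  \<open>M\<close>, so the unit law of \<open>M\<close> as a lax functor applies once
  \<open>k\<close> has been split off.\<close>

lemma kleisli_luni_nat:
  assumes f: "f \<in> hom (kleisli W M) A B"
  shows "(Ide (kleisli W M) (Unit (kleisli W M)) \<otimes>\<^bsub>kleisli W M\<^esub> f) \<Zsemi>\<^bsub>kleisli W M\<^esub> LUni (kleisli W M) B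
    = LUni (kleisli W M) A \<Zsemi>\<^bsub>kleisli W M\<^esub> f"
proof (rule hom_kleisliE[OF f])
  fix k
  assume *: "f = (A, k, B)" "k \<in> Arr W" "Dom W k = A" "Cod W k = FO M B" "A \<in> Obj W" "B \<in> Obj W"
  have "(Eta M (Unit W) \<otimes>\<^bsub>W\<^esub> k) \<Zsemi>\<^bsub>W\<^esub> (Nabla M (Unit W) B \<Zsemi>\<^bsub>W\<^esub> FA M (LUni W B))
    = (Ide W (Unit W) \<otimes>\<^bsub>W\<^esub> k) \<Zsemi>\<^bsub>W\<^esub> ((Eta M (Unit W) \<otimes>\<^bsub>W\<^esub> Ide W (FO M B))
      \<Zsemi>\<^bsub>W\<^esub> (Nabla M (Unit W) B \<Zsemi>\<^bsub>W\<^esub> FA M (LUni W B)))"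
    using * by (simp add: lax.V.ten_comp_comp_arr)
  also have "\<dots> = LUni W A \<Zsemi>\<^bsub>W\<^esub> k"
    using * lax.V.luni_nat_arr[of k] by (simp add: nabla_luni)
  finally show ?thesis
    using * comp_kl_functor[of "LUni W B" "Unit W \<odot>\<^bsub>W\<^esub> A"] kl_functor_comp[of "LUni W A"]
    by (simp add: kleisli_sel W_assoc)
qed

lemma kleisli_runi_nat:
  assumes f: "f \<in> hom (kleisli W M) A B"
  shows "(f \<otimes>\<^bsub>kleisli W M\<^esub> Ide (kleisli W M) (Unit (kleisli W M))) \<Zsemi>\<^bsub>kleisli W M\<^esub> RUni (kleisli W M) B
    = RUni (kleisli W M) A \<Zsemi>\<^bsub>kleisli W M\<^esub> f"
proof (rule hom_kleisliE[OF f])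
  fix k
  assume *: "f = (A, k, B)" "k \<in> Arr W" "Dom W k = A" "Cod W k = FO M B" "A \<in> Obj W" "B \<in> Obj W"
  have "(k \<otimes>\<^bsub>W\<^esub> Eta M (Unit W)) \<Zsemi>\<^bsub>W\<^esub> (Nabla M B (Unit W) \<Zsemi>\<^bsub>W\<^esub> FA M (RUni W B))
    = (k \<otimes>\<^bsub>W\<^esub> Ide W (Unit W)) \<Zsemi>\<^bsub>W\<^esub> ((Ide W (FO M B) \<otimes>\<^bsub>W\<^esub> Eta M (Unit W))
      \<Zsemi>\<^bsub>W\<^esub> (Nabla M B (Unit W) \<Zsemi>\<^bsub>W\<^esub> FA M (RUni W B)))"
    using * by (simp add: lax.V.ten_comp_comp_arr)
  also have "\<dots> = RUni W A \<Zsemi>\<^bsub>W\<^esub> k"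
    using * lax.V.runi_nat_arr[of k] by (simp add: nabla_runi)
  finally show ?thesis
    using * comp_kl_functor[of "RUni W B" "A \<odot>\<^bsub>W\<^esub> Unit W"] kl_functor_comp[of "RUni W A"]
    by (simp add: kleisli_sel W_assoc)
qed

lemma monoidal_category_kleisli: "monoidal_category (kleisli W M)"
proof (intro monoidal_category.intro monoidal_category_axioms.intro category_kleisli)
  fix f A B g A' B'
  assume f: "f \<in> hom (kleisli W M) A B" and g: "g \<in> hom (kleisli W M) A' B'"
  show "f \<otimes>\<^bsub>kleisli W M\<^esub> g \<in> hom (kleisli W M) (A \<odot>\<^bsub>kleisli W M\<^esub> A') (B \<odot>\<^bsub>kleisli W M\<^esub> B')"
    by (rule hom_kleisliE[OF f], rule hom_kleisliE[OF g]) (simp add: kleisli_sel hom_def)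
next
  fix A B D E
  assume "A \<in> Obj (kleisli W M)" and "B \<in> Obj (kleisli W M)" 
  then have [simp]: "A \<in> Obj W" "B \<in> Obj W" by (simp_all add: kleisli_sel)
  show "Assoc (kleisli W M) A (Unit (kleisli W M)) B \<Zsemi>\<^bsub>kleisli W M\<^esub> (Ide (kleisli W M) A \<otimes>\<^bsub>kleisli W M\<^esub> LUni (kleisli W M) B)
    = RUni (kleisli W M) A \<otimes>\<^bsub>kleisli W M\<^esub> Ide (kleisli W M) B"
    using lax.V.triangle[of A B] 
    by (simp add: kleisli_sel(9-12) ide_kleisli flip: kl_functor_ten L.comp_arr)
  assume "D \<in> Obj (kleisli W M)"
  then have [simp]: "D \<in> Obj W" by (simp add: kleisli_sel)
  show "is_iso (kleisli W M) (Assoc (kleisli W M) A B D)"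
    by (simp add: kleisli_sel L.preserves_iso lax.V.assoc_iso)
  assume "E \<in> Obj (kleisli W M)"
  then have [simp]: "E \<in> Obj W" by (simp add: kleisli_sel)
  show "Assoc (kleisli W M) (A \<odot>\<^bsub>kleisli W M\<^esub> B) D E \<Zsemi>\<^bsub>kleisli W M\<^esub> Assoc (kleisli W M) A B (D \<odot>\<^bsub>kleisli W M\<^esub> E)
    = (Assoc (kleisli W M) A B D \<otimes>\<^bsub>kleisli W M\<^esub> Ide (kleisli W M) E)
      \<Zsemi>\<^bsub>kleisli W M\<^esub> Assoc (kleisli W M) A (B \<odot>\<^bsub>kleisli W M\<^esub> D) E
      \<Zsemi>\<^bsub>kleisli W M\<^esub> (Ide (kleisli W M) A \<otimes>\<^bsub>kleisli W M\<^esub> Assoc (kleisli W M) B D E)"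
    using lax.V.pentagon[of A B D E] 
    by (simp add: kleisli_sel(7,10) ide_kleisli flip: kl_functor_ten L.comp_arr)
next
  fix A B
  assume "A \<in> Obj (kleisli W M)" and "B \<in> Obj (kleisli W M)"
  then show "Ide (kleisli W M) A \<otimes>\<^bsub>kleisli W M\<^esub> Ide (kleisli W M) B
    = Ide (kleisli W M) (A \<odot>\<^bsub>kleisli W M\<^esub> B)"
    by (simp add: kleisli_sel eta_nabla)
next
  fix A
  assume "A \<in> Obj (kleisli W M)"
  then have [simp]: "A \<in> Obj W" by (simp add: kleisli_sel)
  show "is_iso (kleisli W M) (LUni (kleisli W M) A)" "is_iso (kleisli W M) (RUni (kleisli W M) A)"
    by (simp_all add: kleisli_sel(11,12) L.preserves_iso lax.V.luni_iso lax.V.runi_iso)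
qed (fact kleisli_ten_comp kleisli_assoc_nat kleisli_luni_nat kleisli_runi_nat
  | simp add: kleisli_sel hom_def kl_functor_sel)+

end

section \<open>The 2-category of parametric arrows\<close>

locale parametric_arrows =
  monad: symmetric_monoidal_monad W M +
  full_strict_monoidal_subcategory W U +
  F: lax_symmetric_monoidal_functor V W F +
  C: monoidal_vcategory V C
  for V :: "('vo, 'va) smcat" and W :: "('wo, 'wa) smcat" and M :: "('wo, 'wa) mon_monad"
    and F :: "('vo, 'va, 'wo, 'wa) lax_func" and U :: "'wo set" and C :: "('c, 'vo, 'va) mvcat"
begin

abbreviation "Kl \<equiv> kleisli W M"
abbreviation "L \<equiv> kl_functor W M"
abbreviation "D \<equiv> change_base W F C"
abbreviation "Hr \<equiv> param_hor W M F U C"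
abbreviation "Vr \<equiv> param_ver W M F U C"
abbreviation "Para \<equiv> param2 W M F U C"

sublocale K: monoidal_category Kl
  by (rule monad.monoidal_category_kleisli)

sublocale D: vcategory W D
  by (rule vcategory_change_base[OF F.lax_symmetric_monoidal_functor_axioms C.vcategory_axioms])

lemmas Kl_assoc = monad.L.D.comp_assoc_arr

lemma kl_simps [simp]:
  "Obj Kl = Obj W" "A \<odot>\<^bsub>Kl\<^esub> B = A \<odot>\<^bsub>W\<^esub> B" "Unit Kl = Unit W" "FO L A = A"
  by (simp_all add: kleisli_sel kl_functor_sel)

section \<open>Strictness on parameter objects\<close>

lemma U_obj [simp]: "A \<in> U \<Longrightarrow> A \<in> Obj W"
  using sub by blast

declare unit_in [simp] ten_in [simp]

text \<open>Associators and unitors of the Kleisli category are images of those of \<open>W\<close>,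
  and functors preserve identities. So strictness on \<open>U\<close> carries over.\<close>

lemma assoc_kl_ide: "\<lbrakk>A \<in> U; B \<in> U; E \<in> U\<rbrakk> \<Longrightarrow> Assoc Kl A B E = Ide Kl (A \<odot>\<^bsub>W\<^esub> (B \<odot>\<^bsub>W\<^esub> E))"
  by (simp add: kleisli_sel(10) assoc_ide monad.L.ide)

lemma luni_kl_ide: "A \<in> U \<Longrightarrow> LUni Kl A = Ide Kl A"
  by (simp add: kleisli_sel(11) luni_ide monad.L.ide)

lemma runi_kl_ide: "A \<in> U \<Longrightarrow> RUni Kl A = Ide Kl A"
  by (simp add: kleisli_sel(12) runi_ide monad.L.ide)

text \<open>Only the domains are parameter objects. The codomains will be hom-objects, which need
  not lie in \<open>U\<close>, so the associator on that side has to stay; the one that naturality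
  puts at the front is an identity.\<close>

lemma kl_ten_strict_assoc:
  assumes "f \<in> Arr Kl" "g \<in> Arr Kl" "h \<in> Arr Kl" "Dom Kl f \<in> U" "Dom Kl g \<in> U" "Dom Kl h \<in> U"
  shows "((f \<otimes>\<^bsub>Kl\<^esub> g) \<otimes>\<^bsub>Kl\<^esub> h) \<Zsemi>\<^bsub>Kl\<^esub> Assoc Kl (Cod Kl f) (Cod Kl g) (Cod Kl h)
    = f \<otimes>\<^bsub>Kl\<^esub> (g \<otimes>\<^bsub>Kl\<^esub> h)"
  using assms by (simp add: K.assoc_nat_arr assoc_kl_ide)

section \<open>Composition and identities of the base change as Kleisli arrows\<close>

abbreviation H where "H X Y \<equiv> FO F (VHom C X Y)"
definition c where "c X Y Z = FA L (VComp D X Y Z)"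
definition j where "j X = FA L (VId D X)"

lemma D_simps [simp]:
  "VObj D = VObj C" "VHom D X Y = H X Y"
  by (simp_all add: change_base_def)

lemma H_obj [simp]: "\<lbrakk>X \<in> VObj C; Y \<in> VObj C\<rbrakk> \<Longrightarrow> H X Y \<in> Obj W"
  by (simp add: C.vhom)

lemma D_arr [simp]:
  "\<lbrakk>X \<in> VObj C; Y \<in> VObj C; Z \<in> VObj C\<rbrakk> \<Longrightarrow> VComp D X Y Z \<in> Arr W"
  "\<lbrakk>X \<in> VObj C; Y \<in> VObj C; Z \<in> VObj C\<rbrakk> \<Longrightarrow> Dom W (VComp D X Y Z) = H X Y \<odot>\<^bsub>W\<^esub> H Y Z"
  "\<lbrakk>X \<in> VObj C; Y \<in> VObj C; Z \<in> VObj C\<rbrakk> \<Longrightarrow> Cod W (VComp D X Y Z) = H X Z"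
  "X \<in> VObj C \<Longrightarrow> VId D X \<in> Arr W"
  "X \<in> VObj C \<Longrightarrow> Dom W (VId D X) = Unit W"
  "X \<in> VObj C \<Longrightarrow> Cod W (VId D X) = H X X"
  using D.vcomp_hom[of X Y Z] D.vid_hom[of X] by (auto simp: hom_def)

lemma cj_simps [simp]:
  "\<lbrakk>X \<in> VObj C; Y \<in> VObj C; Z \<in> VObj C\<rbrakk> \<Longrightarrow> c X Y Z \<in> Arr Kl"
  "\<lbrakk>X \<in> VObj C; Y \<in> VObj C; Z \<in> VObj C\<rbrakk> \<Longrightarrow> Dom Kl (c X Y Z) = H X Y \<odot>\<^bsub>W\<^esub> H Y Z"
  "\<lbrakk>X \<in> VObj C; Y \<in> VObj C; Z \<in> VObj C\<rbrakk> \<Longrightarrow> Cod Kl (c X Y Z) = H X Z"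
  "X \<in> VObj C \<Longrightarrow> j X \<in> Arr Kl"
  "X \<in> VObj C \<Longrightarrow> Dom Kl (j X) = Unit W"
  "X \<in> VObj C \<Longrightarrow> Cod Kl (j X) = H X X"
  by (simp_all add: c_def j_def)

text \<open>This is the image of the associativity law of \<open>D\<close> under \<open>L\<close>,
  which preserves composites, products and coherence maps. The unit laws \<open>j_c\<close> and
  \<open>c_j\<close> arise in the same way.\<close>

lemma c_assoc:
  "\<lbrakk>X \<in> VObj C; Y \<in> VObj C; Z \<in> VObj C; T \<in> VObj C\<rbrakk>
    \<Longrightarrow> (c X Y Z \<otimes>\<^bsub>Kl\<^esub> Ide Kl (H Z T)) \<Zsemi>\<^bsub>Kl\<^esub> c X Z T
      = Assoc Kl (H X Y) (H Y Z) (H Z T) \<Zsemi>\<^bsub>Kl\<^esub> ((Ide Kl (H X Y) \<otimes>\<^bsub>Kl\<^esub> c Y Z T) \<Zsemi>\<^bsub>Kl\<^esub> c X Y T)"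
  using D.vcomp_assoc[of X Y Z T]
  by (simp add: c_def monad.ide_kleisli kleisli_sel(10) monad.W_assoc
      flip: monad.kl_functor_ten monad.L.comp_arr)

lemma j_c:
  "\<lbrakk>X \<in> VObj C; Y \<in> VObj C\<rbrakk> \<Longrightarrow> (j X \<otimes>\<^bsub>Kl\<^esub> Ide Kl (H X Y)) \<Zsemi>\<^bsub>Kl\<^esub> c X X Y = LUni Kl (H X Y)"
  using D.vid_comp[of X Y]
  by (simp add: c_def j_def monad.ide_kleisli kleisli_sel(11) flip: monad.kl_functor_ten monad.L.comp_arr)

lemma c_j:
  "\<lbrakk>X \<in> VObj C; Y \<in> VObj C\<rbrakk> \<Longrightarrow> (Ide Kl (H X Y) \<otimes>\<^bsub>Kl\<^esub> j Y) \<Zsemi>\<^bsub>Kl\<^esub> c X Y Y = RUni Kl (H X Y)"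
  using D.vcomp_id[of X Y]
  by (simp add: c_def j_def monad.ide_kleisli kleisli_sel(12) flip: monad.kl_functor_ten monad.L.comp_arr)

section \<open>The category of 0-cells and 1-cells\<close>

lemma hor_sel [simp]:
  "Obj Hr = VObj C"
  "(X, k, Y) \<in> Arr Hr \<longleftrightarrow>
    X \<in> VObj C \<and> Y \<in> VObj C \<and> k \<in> Arr Kl \<and> Dom Kl k \<in> U \<and> Cod Kl k = H X Y"
  "Dom Hr (X, k, Y) = X"
  "Cod Hr (X, k, Y) = Y"
  "Ide Hr X = (X, j X, X)"
  "(X, k, Y) \<Zsemi>\<^bsub>Hr\<^esub> (Y', k', Z) = (X, (k \<otimes>\<^bsub>Kl\<^esub> k') \<Zsemi>\<^bsub>Kl\<^esub> c X Y Z, Z)"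
  by (auto simp: param_hor_def hom_def c_def j_def)

text \<open>The composition arrows \<open>c\<close> are pulled out to the right and rebracketed by
  \<open>c_assoc\<close>. This leaves an associator on hom-objects, which
  \<open>kl_ten_strict_assoc\<close> absorbs into the product of \<open>k\<close>, \<open>l\<close>
  and \<open>m\<close>.\<close>

lemma hor_assoc:
  assumes [simp]: "(X, k, Y) \<in> Arr Hr" "(Y, l, Z) \<in> Arr Hr" "(Z, m, T) \<in> Arr Hr"
  shows "(((k \<otimes>\<^bsub>Kl\<^esub> l) \<Zsemi>\<^bsub>Kl\<^esub> c X Y Z) \<otimes>\<^bsub>Kl\<^esub> m) \<Zsemi>\<^bsub>Kl\<^esub> c X Z T
    = (k \<otimes>\<^bsub>Kl\<^esub> ((l \<otimes>\<^bsub>Kl\<^esub> m) \<Zsemi>\<^bsub>Kl\<^esub> c Y Z T)) \<Zsemi>\<^bsub>Kl\<^esub> c X Y T"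
proof -
  have [simp]: "X \<in> VObj C" "Y \<in> VObj C" "Z \<in> VObj C" "T \<in> VObj C" "k \<in> Arr Kl" "l \<in> Arr Kl" "m \<in> Arr Kl"
    "Dom Kl k \<in> U" "Dom Kl l \<in> U" "Dom Kl m \<in> U" "Cod Kl k = H X Y" "Cod Kl l = H Y Z" "Cod Kl m = H Z T"
    using assms by simp_all
  have "(((k \<otimes>\<^bsub>Kl\<^esub> l) \<Zsemi>\<^bsub>Kl\<^esub> c X Y Z) \<otimes>\<^bsub>Kl\<^esub> m) \<Zsemi>\<^bsub>Kl\<^esub> c X Z T
    = ((k \<otimes>\<^bsub>Kl\<^esub> l) \<otimes>\<^bsub>Kl\<^esub> m) \<Zsemi>\<^bsub>Kl\<^esub> ((c X Y Z \<otimes>\<^bsub>Kl\<^esub> Ide Kl (H Z T)) \<Zsemi>\<^bsub>Kl\<^esub> c X Z T)"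
    by (simp add: K.ten_comp_comp_arr)
  also have "\<dots> = (((k \<otimes>\<^bsub>Kl\<^esub> l) \<otimes>\<^bsub>Kl\<^esub> m) \<Zsemi>\<^bsub>Kl\<^esub> Assoc Kl (H X Y) (H Y Z) (H Z T))
      \<Zsemi>\<^bsub>Kl\<^esub> ((Ide Kl (H X Y) \<otimes>\<^bsub>Kl\<^esub> c Y Z T) \<Zsemi>\<^bsub>Kl\<^esub> c X Y T)"
    by (simp add: c_assoc Kl_assoc)
  also have "\<dots> = (k \<otimes>\<^bsub>Kl\<^esub> (l \<otimes>\<^bsub>Kl\<^esub> m)) \<Zsemi>\<^bsub>Kl\<^esub> ((Ide Kl (H X Y) \<otimes>\<^bsub>Kl\<^esub> c Y Z T) \<Zsemi>\<^bsub>Kl\<^esub> c X Y T)"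
    using kl_ten_strict_assoc[of k l m] by simp
  finally show ?thesis by (simp add: K.ten_comp_comp_arr)
qed

text \<open>Once \<open>j\<close> is separated from \<open>k\<close>, it forms with \<open>c\<close>
  a unitor on the hom-object; naturality moves this unitor to the parameter object, where it is an
  identity.\<close>

lemma hor_unit:
  assumes [simp]: "(X, k, Y) \<in> Arr Hr"
  shows "(j X \<otimes>\<^bsub>Kl\<^esub> k) \<Zsemi>\<^bsub>Kl\<^esub> c X X Y = k" "(k \<otimes>\<^bsub>Kl\<^esub> j Y) \<Zsemi>\<^bsub>Kl\<^esub> c X Y Y = k"
proof -
  have [simp]: "X \<in> VObj C" "Y \<in> VObj C" "k \<in> Arr Kl" "Dom Kl k \<in> U" "Cod Kl k = H X Y"
    using assms by simp_all
  have "(j X \<otimes>\<^bsub>Kl\<^esub> k) \<Zsemi>\<^bsub>Kl\<^esub> c X X Y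
    = (Ide Kl (Unit W) \<otimes>\<^bsub>Kl\<^esub> k) \<Zsemi>\<^bsub>Kl\<^esub> ((j X \<otimes>\<^bsub>Kl\<^esub> Ide Kl (H X Y)) \<Zsemi>\<^bsub>Kl\<^esub> c X X Y)"
    by (simp add: K.ten_comp_comp_arr)
  then show "(j X \<otimes>\<^bsub>Kl\<^esub> k) \<Zsemi>\<^bsub>Kl\<^esub> c X X Y = k"
    using K.luni_nat_arr[of k] by (simp add: j_c luni_kl_ide)
  have "(k \<otimes>\<^bsub>Kl\<^esub> j Y) \<Zsemi>\<^bsub>Kl\<^esub> c X Y Y
    = (k \<otimes>\<^bsub>Kl\<^esub> Ide Kl (Unit W)) \<Zsemi>\<^bsub>Kl\<^esub> ((Ide Kl (H X Y) \<otimes>\<^bsub>Kl\<^esub> j Y) \<Zsemi>\<^bsub>Kl\<^esub> c X Y Y)"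
    by (simp add: K.ten_comp_comp_arr)
  then show "(k \<otimes>\<^bsub>Kl\<^esub> j Y) \<Zsemi>\<^bsub>Kl\<^esub> c X Y Y = k"
    using K.runi_nat_arr[of k] by (simp add: c_j runi_kl_ide)
qed

lemma category_hor: "category Hr"
proof
  fix p X Y assume "p \<in> hom Hr X Y"
  then obtain k where p: "p = (X, k, Y)" "(X, k, Y) \<in> Arr Hr"
    by (cases p) (auto simp: hom_def)
  show "Ide Hr X \<Zsemi>\<^bsub>Hr\<^esub> p = p" "p \<Zsemi>\<^bsub>Hr\<^esub> Ide Hr Y = p"
    using hor_unit[OF p(2)] by (simp_all add: p(1))
  fix q Z assume "q \<in> hom Hr Y Z"
  then obtain l where q: "q = (Y, l, Z)" "(Y, l, Z) \<in> Arr Hr"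
    by (cases q) (auto simp: hom_def)
  show "p \<Zsemi>\<^bsub>Hr\<^esub> q \<in> hom Hr X Z"
    using p q by (auto simp: hom_def)
  fix r T assume "r \<in> hom Hr Z T"
  then obtain m where r: "r = (Z, m, T)" "(Z, m, T) \<in> Arr Hr"
    by (cases r) (auto simp: hom_def)
  show "(p \<Zsemi>\<^bsub>Hr\<^esub> q) \<Zsemi>\<^bsub>Hr\<^esub> r = p \<Zsemi>\<^bsub>Hr\<^esub> (q \<Zsemi>\<^bsub>Hr\<^esub> r)"
    using hor_assoc[OF p(2) q(2) r(2)] by (simp add: p(1) q(1) r(1))
next
  fix p assume "p \<in> Arr Hr"
  then show "Dom Hr p \<in> Obj Hr" "Cod Hr p \<in> Obj Hr" by (cases p; simp)+
qed (simp add: hom_def)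

interpretation Hr: category Hr by (rule category_hor)

text \<open>The Kleisli arrow that a 1-cell consists of and, with \<open>par\<close>, its parameter
  object. They allow 2-cells to be treated without splitting 1-cells into triples.\<close>

definition "ker p = fst (snd p)" for p :: "'c \<times> ('wo \<times> 'wa \<times> 'wo) \<times> 'c"
definition "par p = Dom Kl (ker p)" for p :: "'c \<times> ('wo \<times> 'wa \<times> 'wo) \<times> 'c"

lemma ker_simps [simp]:
  "ker (X, k, Y) = k" "Dom Kl (ker p) = par p" "ker (Ide Hr X) = j X"
  by (simp_all add: ker_def par_def)

lemma par_ide [simp]: "X \<in> VObj C \<Longrightarrow> par (Ide Hr X) = Unit W"
  by (simp add: par_def del: ker_simps(2))

lemma hor_arr [simp]:
  assumes "p \<in> Arr Hr"
  shows "ker p \<in> Arr Kl" "par p \<in> U" "Cod Kl (ker p) = H (Dom Hr p) (Cod Hr p)"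
    "Dom Hr p \<in> VObj C" "Cod Hr p \<in> VObj C"
  using assms by (cases p; simp add: par_def del: ker_simps(2))+

lemma ker_comp:
  "ker (p \<Zsemi>\<^bsub>Hr\<^esub> q) = (ker p \<otimes>\<^bsub>Kl\<^esub> ker q) \<Zsemi>\<^bsub>Kl\<^esub> c (Dom Hr p) (Cod Hr p) (Cod Hr q)"
  by (cases p; cases q) simp

lemma par_comp [simp]:
  "\<lbrakk>p \<in> Arr Hr; q \<in> Arr Hr; Cod Hr p = Dom Hr q\<rbrakk> \<Longrightarrow> par (p \<Zsemi>\<^bsub>Hr\<^esub> q) = par p \<odot>\<^bsub>W\<^esub> par q"
  by (subst par_def) (simp add: ker_comp del: ker_simps(2), simp)

section \<open>2-cells and vertical composition\<close>

lemma ver_sel [simp]: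
  "Obj Vr = Arr Hr"
  "Dom Vr (p, \<phi>, q) = p"
  "Cod Vr (p, \<phi>, q) = q"
  "Ide Vr p = (p, Ide Kl (par p), p)"
  "(p, \<phi>, q) \<Zsemi>\<^bsub>Vr\<^esub> (q', \<psi>, r) = (p, \<phi> \<Zsemi>\<^bsub>Kl\<^esub> \<psi>, r)"
  by (auto simp: param_ver_def par_def ker_def split: prod.splits)

lemma ver_arr_iff:
  "(p, \<phi>, q) \<in> Arr Vr \<longleftrightarrow> p \<in> Arr Hr \<and> q \<in> Arr Hr \<and> Dom Hr p = Dom Hr q \<and> Cod Hr p = Cod Hr q \<and>
    \<phi> \<in> Arr Kl \<and> Dom Kl \<phi> = par p \<and> Cod Kl \<phi> = par q \<and> ker p = \<phi> \<Zsemi>\<^bsub>Kl\<^esub> ker q"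
proof -
  obtain X k Y X' k' Y' where "p = (X, k, Y)" "q = (X', k', Y')" by (cases p, cases q)
  then show ?thesis
    by (simp add: param_ver_def hom_def par_def del: hor_sel(2) ker_simps(2))
qed

lemma hom_verE:
  assumes "\<alpha> \<in> hom Vr p q"
  obtains \<phi> where "\<alpha> = (p, \<phi>, q)" "p \<in> Arr Hr" "q \<in> Arr Hr" "Dom Hr p = Dom Hr q" "Cod Hr p = Cod Hr q"
    "\<phi> \<in> Arr Kl" "Dom Kl \<phi> = par p" "Cod Kl \<phi> = par q" "ker p = \<phi> \<Zsemi>\<^bsub>Kl\<^esub> ker q"
proof -
  obtain p' \<phi> q' where "\<alpha> = (p', \<phi>, q')" by (cases \<alpha>)
  with assms that[of \<phi>] show thesis by (auto simp: hom_def ver_arr_iff)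
qed

lemma category_ver: "category Vr"
proof
  fix \<alpha> assume "\<alpha> \<in> Arr Vr"
  then have "\<alpha> \<in> hom Vr (Dom Vr \<alpha>) (Cod Vr \<alpha>)" by (simp add: hom_def)
  then show "Dom Vr \<alpha> \<in> Obj Vr" "Cod Vr \<alpha> \<in> Obj Vr" by (auto elim: hom_verE)
next
  fix p assume "p \<in> Obj Vr"
  then show "Ide Vr p \<in> hom Vr p p" by (simp add: hom_def ver_arr_iff)
next
  fix \<alpha> p q assume "\<alpha> \<in> hom Vr p q"
  then obtain \<phi> where a: "\<alpha> = (p, \<phi>, q)" "p \<in> Arr Hr" "q \<in> Arr Hr" "Dom Hr p = Dom Hr q"
    "Cod Hr p = Cod Hr q" "\<phi> \<in> Arr Kl" "Dom Kl \<phi> = par p" "Cod Kl \<phi> = par q"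
    "ker p = \<phi> \<Zsemi>\<^bsub>Kl\<^esub> ker q"
    by (rule hom_verE)
  then show "Ide Vr p \<Zsemi>\<^bsub>Vr\<^esub> \<alpha> = \<alpha>" "\<alpha> \<Zsemi>\<^bsub>Vr\<^esub> Ide Vr q = \<alpha>" by simp_all
  fix \<beta> r assume "\<beta> \<in> hom Vr q r"
  then obtain \<psi> where b: "\<beta> = (q, \<psi>, r)" "r \<in> Arr Hr" "Dom Hr q = Dom Hr r"
    "Cod Hr q = Cod Hr r" "\<psi> \<in> Arr Kl" "Dom Kl \<psi> = par q" "Cod Kl \<psi> = par r"
    "ker q = \<psi> \<Zsemi>\<^bsub>Kl\<^esub> ker r"
    by (rule hom_verE)
  with a show "\<alpha> \<Zsemi>\<^bsub>Vr\<^esub> \<beta> \<in> hom Vr p r"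
    by (simp add: hom_def ver_arr_iff Kl_assoc)
  fix \<gamma> s assume "\<gamma> \<in> hom Vr r s"
  then obtain \<chi> where "\<gamma> = (r, \<chi>, s)" "\<chi> \<in> Arr Kl" "Dom Kl \<chi> = par r"
    by (rule hom_verE)
  with a b show "(\<alpha> \<Zsemi>\<^bsub>Vr\<^esub> \<beta>) \<Zsemi>\<^bsub>Vr\<^esub> \<gamma> = \<alpha> \<Zsemi>\<^bsub>Vr\<^esub> (\<beta> \<Zsemi>\<^bsub>Vr\<^esub> \<gamma>)"
    by (simp add: Kl_assoc)
qed

section \<open>Horizontal composition and the laws of a strict 2-category\<close>

lemma param2_sel [simp]:
  "Hor Para = Hr" "Ver Para = Vr"
  "(p\<^sub>1, \<phi>\<^sub>1, q\<^sub>1) \<star>\<^bsub>Para\<^esub> (p\<^sub>2, \<phi>\<^sub>2, q\<^sub>2) = (p\<^sub>1 \<Zsemi>\<^bsub>Hr\<^esub> p\<^sub>2, \<phi>\<^sub>1 \<otimes>\<^bsub>Kl\<^esub> \<phi>\<^sub>2, q\<^sub>1 \<Zsemi>\<^bsub>Hr\<^esub> q\<^sub>2)"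
  by (simp_all add: param2_def Let_def)

text \<open>With \<open>k\<close> and \<open>l\<close> the Kleisli arrows of the target 1-cells and
  \<open>m\<close> a composition arrow \<open>c\<close>, this is the commuting triangle required of
  a horizontal composite of 2-cells.\<close>

lemma kl_hcomp:
  assumes "\<phi> \<in> Arr Kl" "k \<in> Arr Kl" "Cod Kl \<phi> = Dom Kl k"
    and "\<psi> \<in> Arr Kl" "l \<in> Arr Kl" "Cod Kl \<psi> = Dom Kl l"
    and "m \<in> Arr Kl" "Dom Kl m = Cod Kl k \<odot>\<^bsub>W\<^esub> Cod Kl l"
  shows "((\<phi> \<Zsemi>\<^bsub>Kl\<^esub> k) \<otimes>\<^bsub>Kl\<^esub> (\<psi> \<Zsemi>\<^bsub>Kl\<^esub> l)) \<Zsemi>\<^bsub>Kl\<^esub> m = (\<phi> \<otimes>\<^bsub>Kl\<^esub> \<psi>) \<Zsemi>\<^bsub>Kl\<^esub> ((k \<otimes>\<^bsub>Kl\<^esub> l) \<Zsemi>\<^bsub>Kl\<^esub> m)"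
  using assms by (simp add: K.ten_comp_comp_arr)

text \<open>A 2-cell has parameter objects at both ends, so both unitors in the naturality square
  are identities. The same holds for associators in \<open>kl_ten_assoc\<close>, which is why
  horizontal composition is strict.\<close>

lemma kl_ten_unit:
  assumes "\<phi> \<in> Arr Kl" "Dom Kl \<phi> \<in> U" "Cod Kl \<phi> \<in> U"
  shows "Ide Kl (Unit W) \<otimes>\<^bsub>Kl\<^esub> \<phi> = \<phi>" "\<phi> \<otimes>\<^bsub>Kl\<^esub> Ide Kl (Unit W) = \<phi>"
  using assms K.luni_nat_arr[of \<phi>] K.runi_nat_arr[of \<phi>]
  by (simp_all add: luni_kl_ide unit_ten runi_kl_ide ten_unit)

lemma kl_ten_assoc:
  assumes "\<phi> \<in> Arr Kl" "Dom Kl \<phi> \<in> U" "Cod Kl \<phi> \<in> U"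
    "\<psi> \<in> Arr Kl" "Dom Kl \<psi> \<in> U" "Cod Kl \<psi> \<in> U"
    "\<chi> \<in> Arr Kl" "Dom Kl \<chi> \<in> U" "Cod Kl \<chi> \<in> U"
  shows "(\<phi> \<otimes>\<^bsub>Kl\<^esub> \<psi>) \<otimes>\<^bsub>Kl\<^esub> \<chi> = \<phi> \<otimes>\<^bsub>Kl\<^esub> (\<psi> \<otimes>\<^bsub>Kl\<^esub> \<chi>)"
  using assms kl_ten_strict_assoc[of \<phi> \<psi> \<chi>] by (simp add: assoc_kl_ide ten_assoc)

lemma two_category_param2: "two_category Para"
proof (rule two_category.intro)
  show "category (Hor Para)" "category (Ver Para)" "Obj (Ver Para) = Arr (Hor Para)"
    by (simp_all add: category_hor category_ver)
next
  fix \<alpha> f f' assume "\<alpha> \<in> hom (Ver Para) f f'"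
  then have "\<alpha> \<in> hom Vr f f'" by simp
  then obtain \<phi> where a: "\<alpha> = (f, \<phi>, f')" "f \<in> Arr Hr" "f' \<in> Arr Hr" "Dom Hr f = Dom Hr f'"
    "Cod Hr f = Cod Hr f'" "\<phi> \<in> Arr Kl" "Dom Kl \<phi> = par f" "Cod Kl \<phi> = par f'"
    "ker f = \<phi> \<Zsemi>\<^bsub>Kl\<^esub> ker f'"
    by (rule hom_verE)
  then show "Dom (Hor Para) f = Dom (Hor Para) f' \<and> Cod (Hor Para) f = Cod (Hor Para) f'" by simp
  \<comment> \<open>The outer components agree by the unit laws of \<open>Hr\<close>, the middle one
    by \<open>kl_ten_unit\<close>. Removing \<open>hor_sel\<close> keeps the identity 1-cells
    folded, so that those laws can apply.\<close>
  show "Ide (Ver Para) (Ide (Hor Para) (Dom (Hor Para) f)) \<star>\<^bsub>Para\<^esub> \<alpha> = \<alpha>"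
    "\<alpha> \<star>\<^bsub>Para\<^esub> Ide (Ver Para) (Ide (Hor Para) (Cod (Hor Para) f)) = \<alpha>"
    using a(1-8) by (simp_all add: kl_ten_unit del: hor_sel)
  fix \<beta> g g' assume "\<beta> \<in> hom (Ver Para) g g'"
  then have "\<beta> \<in> hom Vr g g'" by simp
  then obtain \<psi> where b: "\<beta> = (g, \<psi>, g')" "g \<in> Arr Hr" "g' \<in> Arr Hr" "Dom Hr g = Dom Hr g'"
    "Cod Hr g = Cod Hr g'" "\<psi> \<in> Arr Kl" "Dom Kl \<psi> = par g" "Cod Kl \<psi> = par g'"
    "ker g = \<psi> \<Zsemi>\<^bsub>Kl\<^esub> ker g'"
    by (rule hom_verE)
  assume fg: "Cod (Hor Para) f = Dom (Hor Para) g"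
  with a b show "\<alpha> \<star>\<^bsub>Para\<^esub> \<beta> \<in> hom (Ver Para) (f \<Zsemi>\<^bsub>Hor Para\<^esub> g) (f' \<Zsemi>\<^bsub>Hor Para\<^esub> g')"
    by (simp add: hom_def ver_arr_iff ker_comp kl_hcomp)
  fix \<gamma> h h' assume "\<gamma> \<in> hom (Ver Para) h h'"
  then have "\<gamma> \<in> hom Vr h h'" by simp
  then obtain \<chi> where c: "\<gamma> = (h, \<chi>, h')" "h \<in> Arr Hr" "h' \<in> Arr Hr" "Dom Hr h = Dom Hr h'"
    "Cod Hr h = Cod Hr h'" "\<chi> \<in> Arr Kl" "Dom Kl \<chi> = par h" "Cod Kl \<chi> = par h'"
    by (rule hom_verE)
  assume "Cod (Hor Para) g = Dom (Hor Para) h"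
  with a(1-8) b(1-8) c fg
  show "(\<alpha> \<star>\<^bsub>Para\<^esub> \<beta>) \<star>\<^bsub>Para\<^esub> \<gamma> = \<alpha> \<star>\<^bsub>Para\<^esub> (\<beta> \<star>\<^bsub>Para\<^esub> \<gamma>)"
    by (simp add: kl_ten_assoc Hr.comp_assoc_arr)
next
  fix \<alpha> f f' \<alpha>' f'' \<beta> g g' \<beta>' g''
  assume "\<alpha> \<in> hom (Ver Para) f f'" and "\<alpha>' \<in> hom (Ver Para) f' f''"
    and "\<beta> \<in> hom (Ver Para) g g'" and "\<beta>' \<in> hom (Ver Para) g' g''"
  then show "(\<alpha> \<Zsemi>\<^bsub>Ver Para\<^esub> \<alpha>') \<star>\<^bsub>Para\<^esub> (\<beta> \<Zsemi>\<^bsub>Ver Para\<^esub> \<beta>') = (\<alpha> \<star>\<^bsub>Para\<^esub> \<beta>) \<Zsemi>\<^bsub>Ver Para\<^esub> (\<alpha>' \<star>\<^bsub>Para\<^esub> \<beta>')"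
    by (auto elim!: hom_verE simp: K.ten_comp_arr)
next
  fix f X Y g Z assume "f \<in> hom (Hor Para) X Y" "g \<in> hom (Hor Para) Y Z"
  then show "Ide (Ver Para) f \<star>\<^bsub>Para\<^esub> Ide (Ver Para) g = Ide (Ver Para) (f \<Zsemi>\<^bsub>Hor Para\<^esub> g)"
    by (simp add: hom_def K.ten_ide)
qed

end

section \<open>The inclusion of the underlying category\<close>

lemma category_truncate:
  assumes "category C"
  shows "category (cat.truncate C)"
proof -
  interpret category C by (rule assms)
  show ?thesis
    by standard
      (simp_all add: cat.defs hom_def comp_assoc_arr)
qed

lemma hom_truncate [simp]: "hom (cat.truncate C) A B = hom C A B"
  by (simp add: hom_def cat.defs)

lemma discrete2_sel [simp]:
  "Hor (discrete2 C) = cat.truncate C"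
  "Obj (Ver (discrete2 C)) = Arr C" "Arr (Ver (discrete2 C)) = Arr C"
  "Dom (Ver (discrete2 C)) f = f" "Cod (Ver (discrete2 C)) f = f" "Ide (Ver (discrete2 C)) f = f"
  "f \<Zsemi>\<^bsub>Ver (discrete2 C)\<^esub> g = f"
  "f \<star>\<^bsub>discrete2 C\<^esub> g = f \<Zsemi>\<^bsub>C\<^esub> g"
  "Ten0 (discrete2 C) = TenO C" "Ten1 (discrete2 C) = TenA C" "Ten2 (discrete2 C) = TenA C"
  "Unit0 (discrete2 C) = Unit C" "Assoc1 (discrete2 C) = Assoc C" "LUni1 (discrete2 C) = LUni C"
  "RUni1 (discrete2 C) = RUni C" "Sym1 (discrete2 C) = Sym C"
  "Inter (discrete2 C) f\<^sub>1 g\<^sub>1 f\<^sub>2 g\<^sub>2 = (f\<^sub>1 \<Zsemi>\<^bsub>C\<^esub> g\<^sub>1) \<otimes>\<^bsub>C\<^esub> (f\<^sub>2 \<Zsemi>\<^bsub>C\<^esub> g\<^sub>2)"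
  by (simp_all add: discrete2_def)

lemma truncate_sel [simp]:
  "Obj (cat.truncate C) = Obj C" "Arr (cat.truncate C) = Arr C" "Dom (cat.truncate C) = Dom C"
  "Cod (cat.truncate C) = Cod C" "Ide (cat.truncate C) = Ide C" "Comp (cat.truncate C) = Comp C"
  by (simp_all add: cat.defs)

lemma hom_discrete2 [simp]: "hom (Ver (discrete2 C)) f g = {h \<in> Arr C. h = f \<and> h = g}"
  by (auto simp: hom_def)

lemma two_category_discrete2:
  assumes "category C"
  shows "two_category (discrete2 C)"
proof -
  interpret category C by (rule assms)
  show ?thesis
  proof (rule two_category.intro)
    show "category (Hor (discrete2 C))" by (simp add: category_truncate assms)
    show "category (Ver (discrete2 C))"
      by standard auto
  qed (auto simp: hom_def comp_assoc_arr)
qed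

context parametric_arrows
begin

section \<open>Construction of the inclusion\<close>

abbreviation "C\<^sub>0 \<equiv> mon_underlying V C"
abbreviation "I \<equiv> Unit V"
abbreviation "I\<^sub>W \<equiv> Unit W"

lemma mon_underlying_sel [simp]:
  "Obj C\<^sub>0 = VObj C"
  "(X, f, Y) \<in> Arr C\<^sub>0 \<longleftrightarrow>
    X \<in> VObj C \<and> Y \<in> VObj C \<and> f \<in> Arr V \<and> Dom V f = Unit V \<and> Cod V f = VHom C X Y"
  "Dom C\<^sub>0 (X, f, Y) = X" "Cod C\<^sub>0 (X, f, Y) = Y" "Ide C\<^sub>0 X = (X, VId C X, X)"
  "(X, f, Y) \<Zsemi>\<^bsub>C\<^sub>0\<^esub> (Y', g, Z) =
    (X, inv_arr V (LUni V I) \<Zsemi>\<^bsub>V\<^esub> (f \<otimes>\<^bsub>V\<^esub> g) \<Zsemi>\<^bsub>V\<^esub> VComp C X Y Z, Z)"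
  "TenO C\<^sub>0 = VTenO C"
  "(X, f, Y) \<otimes>\<^bsub>C\<^sub>0\<^esub> (X', g, Y') =
    (VTenO C X X', inv_arr V (LUni V I) \<Zsemi>\<^bsub>V\<^esub> (f \<otimes>\<^bsub>V\<^esub> g) \<Zsemi>\<^bsub>V\<^esub> VTenA C X X' Y Y', VTenO C Y Y')"
  "Unit C\<^sub>0 = VUnit C"
  "Assoc C\<^sub>0 X Y Z = (VTenO C (VTenO C X Y) Z, VAssoc C X Y Z, VTenO C X (VTenO C Y Z))"
  "LUni C\<^sub>0 X = (VTenO C (VUnit C) X, VLUni C X, X)"
  "RUni C\<^sub>0 X = (VTenO C X (VUnit C), VRUni C X, X)"
  "Sym C\<^sub>0 X Y = (VTenO C X Y, VSym C X Y, VTenO C Y X)"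
  by (auto simp: mon_underlying_def underlying_def cat.defs hom_def)

sublocale C\<^sub>0: monoidal_category C\<^sub>0
  by (rule C.underlying_monoidal)

text \<open>The formula \<open>param_coh\<close> is also the one that defines the coherence 1-cells
  of the target, so associators, unitors and symmetries are preserved by unfolding.\<close>

definition incl1 where "incl1 = (\<lambda>(X, f, Y). (X, param_coh W M F f, Y))"
definition incl2 where "incl2 f = Ide Vr (incl1 f)"

lemma incl1_arr:
  assumes "f \<in> Arr C\<^sub>0"
  shows "incl1 f \<in> Arr Hr" "Dom Hr (incl1 f) = Dom C\<^sub>0 f" "Cod Hr (incl1 f) = Cod C\<^sub>0 f" "par (incl1 f) = I\<^sub>W"
  using assms by (cases f; simp add: incl1_def param_coh_def par_def del: ker_simps(2))+

text \<open>The two domains agree because \<open>I\<^sub>W \<odot> I\<^sub>W\<close> is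
  \<open>I\<^sub>W\<close>. Inserting the left unitor of \<open>I\<close> and its inverse makes the
  unit law of \<open>F\<close> applicable; it leaves the left unitor of \<open>FO F I\<close>, and
  by naturality this becomes the unitor of \<open>I\<^sub>W\<close>, an identity, followed by
  \<open>LaxU F\<close>.\<close>

lemma laxU_ten: "(LaxU F \<otimes>\<^bsub>W\<^esub> LaxU F) \<Zsemi>\<^bsub>W\<^esub> LaxT F I I = LaxU F \<Zsemi>\<^bsub>W\<^esub> FA F (inv_arr V (LUni V I))"
proof -
  have l: "LUni W I\<^sub>W = Ide W I\<^sub>W" by (simp add: luni_ide)
  have "(LaxU F \<otimes>\<^bsub>W\<^esub> LaxU F) \<Zsemi>\<^bsub>W\<^esub> LaxT F I I
    = (LaxU F \<otimes>\<^bsub>W\<^esub> LaxU F) \<Zsemi>\<^bsub>W\<^esub> (LaxT F I I \<Zsemi>\<^bsub>W\<^esub> FA F (LUni V I \<Zsemi>\<^bsub>V\<^esub> inv_arr V (LUni V I)))"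
    by (simp add: F.ide)
  \<comment> \<open>The rule \<open>inv_luni_unit(4)\<close> is removed so that the inserted pair is
    not cancelled before \<open>F\<close> is distributed over it.\<close>
  also have "\<dots> = (Ide W I\<^sub>W \<otimes>\<^bsub>W\<^esub> LaxU F) \<Zsemi>\<^bsub>W\<^esub> ((LaxU F \<otimes>\<^bsub>W\<^esub> Ide W (FO F I)) \<Zsemi>\<^bsub>W\<^esub> LaxT F I I \<Zsemi>\<^bsub>W\<^esub> FA F (LUni V I))
      \<Zsemi>\<^bsub>W\<^esub> FA F (inv_arr V (LUni V I))"
    by (simp add: F.comp_arr monad.W_assoc monad.lax.V.ten_comp_comp_arr del: F.V.inv_luni_unit(4))
  also have "\<dots> = LaxU F \<Zsemi>\<^bsub>W\<^esub> FA F (inv_arr V (LUni V I))"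
    using monad.lax.V.luni_nat_arr[of "LaxU F"] by (simp add: F.lax_luni l)
  finally show ?thesis .
qed

text \<open>
  Composition and the monoidal product of \<open>C\<^sub>0\<close> are the instances \<open>h = VComp\<close> and \<open>h = VTenA\<close>, so both
  parts of the functoriality of the inclusion come from this equation.
\<close>

lemma param_coh_ten:
  assumes [simp]: "f \<in> Arr V" "Dom V f = I" "Cod V f = P" "g \<in> Arr V" "Dom V g = I" "Cod V g = Q"
    "h \<in> Arr V" "Dom V h = P \<odot>\<^bsub>V\<^esub> Q"
  shows "param_coh W M F (inv_arr V (LUni V I) \<Zsemi>\<^bsub>V\<^esub> (f \<otimes>\<^bsub>V\<^esub> g) \<Zsemi>\<^bsub>V\<^esub> h)
    = (param_coh W M F f \<otimes>\<^bsub>Kl\<^esub> param_coh W M F g) \<Zsemi>\<^bsub>Kl\<^esub> FA L (LaxT F P Q \<Zsemi>\<^bsub>W\<^esub> FA F h)"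
proof -
  have [simp]: "P \<in> Obj V" "Q \<in> Obj V" using F.C.obj_simps(2)[of f] F.C.obj_simps(2)[of g] by simp_all
  have "((LaxU F \<Zsemi>\<^bsub>W\<^esub> FA F f) \<otimes>\<^bsub>W\<^esub> (LaxU F \<Zsemi>\<^bsub>W\<^esub> FA F g)) \<Zsemi>\<^bsub>W\<^esub> (LaxT F P Q \<Zsemi>\<^bsub>W\<^esub> FA F h)
    = (LaxU F \<otimes>\<^bsub>W\<^esub> LaxU F) \<Zsemi>\<^bsub>W\<^esub> ((FA F f \<otimes>\<^bsub>W\<^esub> FA F g) \<Zsemi>\<^bsub>W\<^esub> (LaxT F P Q \<Zsemi>\<^bsub>W\<^esub> FA F h))"
    by (simp add: monad.lax.V.ten_comp_comp_arr)
  also have "\<dots> = ((LaxU F \<otimes>\<^bsub>W\<^esub> LaxU F) \<Zsemi>\<^bsub>W\<^esub> LaxT F I I) \<Zsemi>\<^bsub>W\<^esub> FA F ((f \<otimes>\<^bsub>V\<^esub> g) \<Zsemi>\<^bsub>V\<^esub> h)"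
    by (simp add: F.laxT_nat_comp monad.W_assoc)
  also have "\<dots> = LaxU F \<Zsemi>\<^bsub>W\<^esub> FA F (inv_arr V (LUni V I) \<Zsemi>\<^bsub>V\<^esub> (f \<otimes>\<^bsub>V\<^esub> g) \<Zsemi>\<^bsub>V\<^esub> h)"
    unfolding laxU_ten by (simp add: monad.W_assoc F.comp_arr F.C.comp_assoc_arr)
  finally show ?thesis
    by (simp add: param_coh_def unit_ten flip: monad.kl_functor_ten monad.L.comp_arr)
qed

lemma incl1_comp:
  assumes "f \<in> Arr C\<^sub>0" "g \<in> Arr C\<^sub>0" "Cod C\<^sub>0 f = Dom C\<^sub>0 g"
  shows "incl1 (f \<Zsemi>\<^bsub>C\<^sub>0\<^esub> g) = incl1 f \<Zsemi>\<^bsub>Hr\<^esub> incl1 g"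
proof -
  obtain X f' Y Y' g' Z where [simp]: "f = (X, f', Y)" "g = (Y', g', Z)" by (cases f, cases g)
  have [simp]: "X \<in> VObj C" "Y \<in> VObj C" "Z \<in> VObj C" using assms by simp_all
  show ?thesis
    using assms C.vcomp_hom[of X Y Z] param_coh_ten[of f' "VHom C X Y" g' "VHom C Y Z" "VComp C X Y Z"]
    by (simp add: incl1_def c_def change_base_def hom_def)
qed

lemma VTenA_arr:
  assumes "X \<in> VObj C" "X' \<in> VObj C" "Y \<in> VObj C" "Y' \<in> VObj C"
  shows "VTenA C X X' Y Y' \<in> Arr V"
    "Dom V (VTenA C X X' Y Y') = VHom C X Y \<odot>\<^bsub>V\<^esub> VHom C X' Y'"
proof -
  interpret T: vfunctor V "vtensor V C C" C "ten_fun C" by (rule C.vten)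
  show "VTenA C X X' Y Y' \<in> Arr V"
    "Dom V (VTenA C X X' Y Y') = VHom C X Y \<odot>\<^bsub>V\<^esub> VHom C X' Y'"
    using assms T.map[of "(X, X')" "(Y, Y')"] by (simp_all add: hom_def ten_fun_def vtensor_def)
qed

lemma incl1_ten:
  assumes "f \<in> Arr C\<^sub>0" "g \<in> Arr C\<^sub>0"
  shows "incl1 (f \<otimes>\<^bsub>C\<^sub>0\<^esub> g) = param_ten1 W M F C (incl1 f) (incl1 g)"
proof -
  obtain X f' Y X' g' Y' where [simp]: "f = (X, f', Y)" "g = (X', g', Y')" by (cases f, cases g)
  have "X \<in> VObj C" "Y \<in> VObj C" "X' \<in> VObj C" "Y' \<in> VObj C" using assms by simp_all
  then show ?thesis
    using assms VTenA_arr[of X X' Y Y']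
      param_coh_ten[of f' "VHom C X Y" g' "VHom C X' Y'" "VTenA C X X' Y Y'"]
    by (simp add: incl1_def param_ten1_def)
qed

lemma incl1_ide: "incl1 (Ide C\<^sub>0 X) = Ide Hr X"
  by (simp add: incl1_def j_def param_coh_def change_base_def)

text \<open>Every 1-cell in the image of the inclusion has parameter object
  \<open>I\<^sub>W\<close>, so this is the exchange that occurs in its interchange cells. The
  associators involved are identities, and \<open>sym_unit\<close> forces the symmetry to be one,
  since both unitors in it are identities.\<close>

lemma mid_exchange_unit: "mid_exchange W I\<^sub>W I\<^sub>W I\<^sub>W I\<^sub>W = Ide W I\<^sub>W"
proof -
  have II: "I\<^sub>W \<odot>\<^bsub>W\<^esub> I\<^sub>W = I\<^sub>W" by (simp add: unit_ten)
  have "Sym W I\<^sub>W I\<^sub>W \<in> hom W I\<^sub>W I\<^sub>W" using monad.lax.V.sym_hom[of I\<^sub>W I\<^sub>W] by (simp add: II)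
  then have "Sym W I\<^sub>W I\<^sub>W = Ide W I\<^sub>W"
    using monad.lax.V.sym_unit[of I\<^sub>W] by (simp add: luni_ide runi_ide hom_def)
  then show ?thesis
    by (simp add: mid_exchange_def assoc_ide II monad.lax.C.inv_arr_ide monad.lax.V.ten_ide)
qed

definition incl where "incl = \<lparr>F0 = \<lambda>X. X, F1 = incl1, F2 = incl2\<rparr>"

lemma incl_sel [simp]: "F0 incl X = X" "F1 incl = incl1" "F2 incl = incl2"
  by (simp_all add: incl_def)

lemma incl2_eq: "f \<in> Arr C\<^sub>0 \<Longrightarrow> incl2 f = (incl1 f, Ide Kl I\<^sub>W, incl1 f)"
  by (simp add: incl2_def incl1_arr)

lemma ide_unit_ten: "Ide Kl I\<^sub>W \<otimes>\<^bsub>Kl\<^esub> Ide Kl I\<^sub>W = Ide Kl I\<^sub>W"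
  by (simp add: K.ten_ide unit_ten)

section \<open>The inclusion is a 2-functor\<close>

lemma two_functor_incl: "two_functor (discrete2 C\<^sub>0) Para incl"
proof (intro two_functor.intro two_functor_axioms.intro)
  show d: "two_category (discrete2 C\<^sub>0)" by (rule two_category_discrete2) (rule C\<^sub>0.category_axioms)
  show p: "two_category Para" by (rule two_category_param2)
  have "category (cat.truncate C\<^sub>0)" "category (Ver (discrete2 C\<^sub>0))"
    using two_category.hor[OF d] two_category.ver[OF d] by simp_all
  \<comment> \<open>The selectors that split cells into triples are removed, so that the lemmas on
    \<open>incl1\<close> apply to whole arrows.\<close>
  then show "is_functor (Hor (discrete2 C\<^sub>0)) (Hor Para) \<lparr>FO = F0 incl, FA = F1 incl\<rparr>"
    "is_functor (Ver (discrete2 C\<^sub>0)) (Ver Para) \<lparr>FO = F1 incl, FA = F2 incl\<rparr>"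
    unfolding is_functor_def is_functor_axioms_def
    by (auto simp: category_hor category_ver hom_def incl1_arr incl1_comp incl2_eq ver_arr_iff
        incl1_ide simp del: hor_sel(2-6) mon_underlying_sel(2-6))
  fix \<alpha> f f' \<beta> g g'
  assume "\<alpha> \<in> hom (Ver (discrete2 C\<^sub>0)) f f'" "\<beta> \<in> hom (Ver (discrete2 C\<^sub>0)) g g'"
    "Cod (Hor (discrete2 C\<^sub>0)) f = Dom (Hor (discrete2 C\<^sub>0)) g"
  then show "F2 incl (\<alpha> \<star>\<^bsub>discrete2 C\<^sub>0\<^esub> \<beta>) = F2 incl \<alpha> \<star>\<^bsub>Para\<^esub> F2 incl \<beta>"
    by (auto simp: incl2_eq incl1_comp ide_unit_ten)
qed

lemma identity_on_objects_incl: "identity_on_objects (discrete2 C\<^sub>0) Para incl"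
  by (simp add: identity_on_objects_def)

section \<open>Strict preservation of the monoidal structure\<close>

lemma param2_ten_sel:
  "Ten0 Para = VTenO C" "Unit0 Para = VUnit C" "Ten1 Para = param_ten1 W M F C"
  "Ten2 Para (p\<^sub>1, \<phi>\<^sub>1, q\<^sub>1) (p\<^sub>2, \<phi>\<^sub>2, q\<^sub>2)
    = (param_ten1 W M F C p\<^sub>1 p\<^sub>2, \<phi>\<^sub>1 \<otimes>\<^bsub>Kl\<^esub> \<phi>\<^sub>2, param_ten1 W M F C q\<^sub>1 q\<^sub>2)"
  "Assoc1 Para X Y Z
    = (VTenO C (VTenO C X Y) Z, param_coh W M F (VAssoc C X Y Z), VTenO C X (VTenO C Y Z))"
  "LUni1 Para X = (VTenO C (VUnit C) X, param_coh W M F (VLUni C X), X)"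
  "RUni1 Para X = (VTenO C X (VUnit C), param_coh W M F (VRUni C X), X)"
  "Sym1 Para X Y = (VTenO C X Y, param_coh W M F (VSym C X Y), VTenO C Y X)"
  "Inter Para f\<^sub>1 g\<^sub>1 f\<^sub>2 g\<^sub>2 =
    (param_ten1 W M F C (f\<^sub>1 \<Zsemi>\<^bsub>Hr\<^esub> g\<^sub>1) (f\<^sub>2 \<Zsemi>\<^bsub>Hr\<^esub> g\<^sub>2),
     FA L (mid_exchange W (par f\<^sub>1) (par g\<^sub>1) (par f\<^sub>2) (par g\<^sub>2)),
     param_ten1 W M F C f\<^sub>1 f\<^sub>2 \<Zsemi>\<^bsub>Hr\<^esub> param_ten1 W M F C g\<^sub>1 g\<^sub>2)"
  by (simp_all add: param2_def Let_def par_def ker_def split: prod.splits)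

lemma preserves_monoidal_strictly_incl: "preserves_monoidal_strictly (discrete2 C\<^sub>0) Para incl"
proof (rule preserves_monoidal_strictly.intro)
  fix f\<^sub>1 X\<^sub>1 Y\<^sub>1 g\<^sub>1 Z\<^sub>1 f\<^sub>2 X\<^sub>2 Y\<^sub>2 g\<^sub>2 Z\<^sub>2
  assume "f\<^sub>1 \<in> hom (Hor (discrete2 C\<^sub>0)) X\<^sub>1 Y\<^sub>1" "g\<^sub>1 \<in> hom (Hor (discrete2 C\<^sub>0)) Y\<^sub>1 Z\<^sub>1"
    "f\<^sub>2 \<in> hom (Hor (discrete2 C\<^sub>0)) X\<^sub>2 Y\<^sub>2" "g\<^sub>2 \<in> hom (Hor (discrete2 C\<^sub>0)) Y\<^sub>2 Z\<^sub>2"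
  then have *: "f\<^sub>1 \<in> Arr C\<^sub>0" "g\<^sub>1 \<in> Arr C\<^sub>0" "f\<^sub>2 \<in> Arr C\<^sub>0" "g\<^sub>2 \<in> Arr C\<^sub>0"
    "Cod C\<^sub>0 f\<^sub>1 = Dom C\<^sub>0 g\<^sub>1" "Cod C\<^sub>0 f\<^sub>2 = Dom C\<^sub>0 g\<^sub>2"
    by (simp_all add: hom_def)
  \<comment> \<open>In the source, \<open>Inter\<close> is the identity 2-cell of a product of
    composites. Its image must also have the target of the interchange cell of \<open>Para\<close>
    as its endpoint, which holds because interchange is an equation in \<open>C\<^sub>0\<close>. The
    middle component is settled by \<open>mid_exchange_unit\<close>.\<close>
  have "incl1 ((f\<^sub>1 \<Zsemi>\<^bsub>C\<^sub>0\<^esub> g\<^sub>1) \<otimes>\<^bsub>C\<^sub>0\<^esub> (f\<^sub>2 \<Zsemi>\<^bsub>C\<^sub>0\<^esub> g\<^sub>2))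
    = incl1 ((f\<^sub>1 \<otimes>\<^bsub>C\<^sub>0\<^esub> f\<^sub>2) \<Zsemi>\<^bsub>C\<^sub>0\<^esub> (g\<^sub>1 \<otimes>\<^bsub>C\<^sub>0\<^esub> g\<^sub>2))"
    using * by (simp add: C\<^sub>0.ten_comp_arr)
  also have "\<dots> = param_ten1 W M F C (incl1 f\<^sub>1) (incl1 f\<^sub>2) \<Zsemi>\<^bsub>Hr\<^esub> param_ten1 W M F C (incl1 g\<^sub>1) (incl1 g\<^sub>2)"
    using * by (simp add: incl1_comp incl1_ten)
  finally show "F2 incl (Inter (discrete2 C\<^sub>0) f\<^sub>1 g\<^sub>1 f\<^sub>2 g\<^sub>2)
    = Inter Para (F1 incl f\<^sub>1) (F1 incl g\<^sub>1) (F1 incl f\<^sub>2) (F1 incl g\<^sub>2)"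
    using * incl1_ten[of "f\<^sub>1 \<Zsemi>\<^bsub>C\<^sub>0\<^esub> g\<^sub>1" "f\<^sub>2 \<Zsemi>\<^bsub>C\<^sub>0\<^esub> g\<^sub>2"]
    by (simp add: incl2_eq param2_ten_sel incl1_arr mid_exchange_unit incl1_comp monad.L.ide)
qed (simp_all add: param2_ten_sel incl1_ten incl2_eq ide_unit_ten, simp_all add: incl1_def)

lemma preserves_symmetry_strictly_incl: "preserves_symmetry_strictly (discrete2 C\<^sub>0) Para incl"
  by (simp add: preserves_symmetry_strictly_def param2_ten_sel incl1_def)

text \<open>On 1-cells, \<open>L\<close> is cancelled first and
  \<open>change_base_functor W F\<close> second. On 2-cells, a hom-set of the discrete vertical
  category has at most one element.\<close>

lemma faithful2_incl:
  assumes "faithful (underlying V C) (change_base_functor W F)" "faithful W L"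
  shows "faithful2 (discrete2 C\<^sub>0) incl"
  unfolding faithful2_def
proof
  show "faithful (Ver (discrete2 C\<^sub>0)) \<lparr>FO = F1 incl, FA = F2 incl\<rparr>"
    by (auto simp: faithful_def inj_on_def)
  have "f = g"
    if "f \<in> hom C\<^sub>0 X Y" "g \<in> hom C\<^sub>0 X Y" "incl1 f = incl1 g" "X \<in> VObj C" "Y \<in> VObj C" for f g X Y
  proof -
    have "f \<in> hom C\<^sub>0 X Y" "g \<in> hom C\<^sub>0 X Y" by (rule that)+
    then obtain f' g' where fg: "f = (X, f', Y)" "g = (X, g', Y)"
      and *: "f' \<in> hom V I (VHom C X Y)" "g' \<in> hom V I (VHom C X Y)"
      by (cases f; cases g) (auto simp: hom_def)
    have "FA L (LaxU F \<Zsemi>\<^bsub>W\<^esub> FA F f') = FA L (LaxU F \<Zsemi>\<^bsub>W\<^esub> FA F g')"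
      using that(3) by (simp add: fg incl1_def param_coh_def)
    \<comment> \<open>Faithfulness of \<open>L\<close> gives injectivity only on a fixed hom-set of
      \<open>W\<close>, so both arrows are first placed in the same one.\<close>
    moreover have "LaxU F \<Zsemi>\<^bsub>W\<^esub> FA F f' \<in> hom W I\<^sub>W (H X Y)" "LaxU F \<Zsemi>\<^bsub>W\<^esub> FA F g' \<in> hom W I\<^sub>W (H X Y)"
      using * by (simp_all add: hom_def)
    ultimately have "LaxU F \<Zsemi>\<^bsub>W\<^esub> FA F f' = LaxU F \<Zsemi>\<^bsub>W\<^esub> FA F g'"
      using assms(2) that(4,5) unfolding faithful_def inj_on_def by (meson H_obj U_obj unit_in)
    then have "FA (change_base_functor W F) f = FA (change_base_functor W F) g"
      by (simp add: fg change_base_functor_def)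
    moreover have "f \<in> hom (underlying V C) X Y" "g \<in> hom (underlying V C) X Y"
      using * that(4,5) by (simp_all add: fg hom_def underlying_def)
    moreover have "X \<in> Obj (underlying V C)" "Y \<in> Obj (underlying V C)"
      using that(4,5) by (simp_all add: underlying_def)
    ultimately show ?thesis using assms(1) unfolding faithful_def inj_on_def by blast
  qed
  then show "faithful (Hor (discrete2 C\<^sub>0)) \<lparr>FO = F0 incl, FA = F1 incl\<rparr>"
    by (simp add: faithful_def inj_on_def)
qed

end

theorem proposition3p14:
  fixes V :: "('vo, 'va) smcat"
    and W :: "('wo, 'wa) smcat"
    and M :: "('wo, 'wa) mon_monad"
    and F :: "('vo, 'va, 'wo, 'wa) lax_func"
    and U :: "'wo set"
    and C :: "('c, 'vo, 'va) mvcat"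
  assumes "symmetric_monoidal_category V"
    and "symmetric_monoidal_category W"
    and "symmetric_monoidal_monad W M"
    and "lax_symmetric_monoidal_functor V W F"
    and "full_strict_monoidal_subcategory W U"
    and "monoidal_vcategory V C"
  shows "\<exists>\<iota>.
    two_functor (discrete2 (mon_underlying V C)) (param2 W M F U C) \<iota> \<and>
    identity_on_objects (discrete2 (mon_underlying V C)) (param2 W M F U C) \<iota> \<and>
    preserves_monoidal_strictly (discrete2 (mon_underlying V C)) (param2 W M F U C) \<iota> \<and>
    (symmetric_monoidal_vcategory V C \<longrightarrow>
      preserves_symmetry_strictly (discrete2 (mon_underlying V C)) (param2 W M F U C) \<iota>) \<and>
    (faithful (underlying V C) (change_base_functor W F) \<and> faithful W (kl_functor W M) \<longrightarrow>
      faithful2 (discrete2 (mon_underlying V C)) \<iota>)"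
proof -
  interpret parametric_arrows V W M F U C
    using assms by (intro parametric_arrows.intro)
  show ?thesis
    using two_functor_incl identity_on_objects_incl preserves_monoidal_strictly_incl
      preserves_symmetry_strictly_incl faithful2_incl
    by blast
qed

end
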